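(* Let $\varphi$ be a real-valued function on $\mathbb{R}/\mathbb{Z}$ with $\int_0^1\varphi\,d\mu=0$ whose Fourier coefficients satisfy $\sum_{p\in\mathbb{Z}}|p|\,|c_p(\varphi)|<+\infty$. Then, as $n\to\infty$, $$\mu\Big\{x:\ \frac{1}{\sqrt n}\sum_{k=0}^{n-1}\varphi(2^kx-x)\le t\Big\}\longrightarrow \frac{1}{\sqrt{2\pi}}\int_0^1\Big(\int_{-\infty}^{t/\sigma(\varphi_y)}e^{-s^2/2}\,ds\Big)\,dy$$ for every $t\in\mathbb{R}$ which is a continuity point of the right-hand side (as a function of $t$).
   Context: $\mu$ is Lebesgue measure on $\mathbb{R}/\mathbb{Z}$ and $c_p(\varphi)$ is the Fourier coefficient of $\varphi$ of order $p$; $\varphi$ is identified with the continuous function equal to the sum of its Fourier series. For $y\in\mathbb{R}/\mathbb{Z}$, $\varphi_y(x):=\varphi(x+y)$. For a function $f$, $\sigma(f)\ge0$ is defined by $\sigma^2(f)=\lim_{n}\frac1n\big\|\sum_{k=0}^{n-1}f(2^k\cdot)\big\|_{L^2(\mu)}^2$ (the asymptotic variance for the map $x\mapsto 2x \bmod 1$). Convention: when $\sigma(\varphi_y)=0$, $\frac{1}{\sqrt{2\pi}}\int_{-\infty}^{t/\sigma(\varphi_y)}e^{-s^2/2}ds$ is interpreted as the distribution function at $t$ of the Dirac mass at $0$. *)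

theory Defs
  imports "HOL-Probability.Probability"
begin

text \<open>Functions on \<open>\<real>/\<int>\<close> are represented by 1-periodic functions on the reals, and the
  Lebesgue measure of \<open>\<real>/\<int>\<close> by its restriction to the fundamental domain \<open>[0, 1)\<close>.\<close>

abbreviation circle_measure :: "real measure" where
  "circle_measure \<equiv> lebesgue_on {0..<1}"

definition fourier_coeff :: "(real \<Rightarrow> real) \<Rightarrow> int \<Rightarrow> complex" where
  "fourier_coeff f p =
     (LINT x|circle_measure. complex_of_real (f x) * exp (- 2 * pi * \<i> * of_int p * of_real x))"

definition circle_L2_norm :: "(real \<Rightarrow> real) \<Rightarrow> real" where
  "circle_L2_norm f = sqrt (LINT x|circle_measure. (f x)\<^sup>2)"

definition translate :: "(real \<Rightarrow> real) \<Rightarrow> real \<Rightarrow> real \<Rightarrow> real" where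
  "translate f y = (\<lambda>x. f (x + y))"

text \<open>Asymptotic standard deviation for the map \<open>x \<mapsto> 2x mod 1\<close>; the value is only meaningful
  when the sequence under \<^const>\<open>lim\<close> converges.\<close>

definition asymp_sd :: "(real \<Rightarrow> real) \<Rightarrow> real" where
  "asymp_sd f =
     sqrt (lim (\<lambda>n. 1 / real n * (circle_L2_norm (\<lambda>x. \<Sum>k<n. f (2 ^ k * x)))\<^sup>2))"

text \<open>Distribution function of the centred Gaussian law with standard deviation \<open>\<sigma> \<ge> 0\<close>,
  which for \<open>\<sigma> = 0\<close> is the Dirac mass at \<open>0\<close>.\<close>

definition gaussian_cdf :: "real \<Rightarrow> real \<Rightarrow> real" where
  "gaussian_cdf \<sigma> t =
     (if \<sigma> = 0 then (if 0 \<le> t then 1 else 0)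
      else 1 / sqrt (2 * pi) * (LBINT s:{..t / \<sigma>}. exp (- s\<^sup>2 / 2)))"

definition mixed_gaussian_cdf :: "(real \<Rightarrow> real) \<Rightarrow> real \<Rightarrow> real" where
  "mixed_gaussian_cdf f t =
     (LINT y|circle_measure. gaussian_cdf (asymp_sd (translate f y)) t)"

end

theory Submission
  imports Defs "HOL-Real_Asymp.Real_Asymp"
begin

text \<open>Summability of \<open>|p| |c\<^sub>p|\<close> makes \<open>\<phi>\<close> Lipschitz. Averaging over the translates of \<open>x\<close> by
  \<open>j / 2\<^sup>m\<close> with \<open>2\<^sup>m\<close> of order \<open>n\<close> leaves \<open>2\<^sup>k x\<close> unchanged modulo 1 for \<open>k \<ge> m\<close> and spreads the
  subtracted \<open>x\<close> uniformly over the circle, so the characteristic function of the normalised sums is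
  asymptotically the average over \<open>a\<close> of the characteristic functions of the normalised Birkhoff
  sums of \<open>\<phi>\<^sub>a\<close> for the doubling map. For each fixed \<open>a\<close> these converge to a Gaussian
  characteristic function, by Gordin's martingale approximation and McLeish's argument; dominated
  convergence and Levy's continuity theorem conclude.\<close>

section \<open>Integrals of periodic functions and the Gordin decomposition\<close>

text \<open>The obstacle is that \<open>\<phi> (2 ^ k * x - x)\<close> depends on \<open>x\<close>
  both directly and through the doubling orbit, so the sum is not a Birkhoff sum of one function.
  Removing the dependence is cheap at the chosen scale: about log n initial terms change by a
  bounded amount each, and rounding a shift to a multiple of \<open>1 / 2 ^ m\<close> moves each of
  the n terms by at most a constant over n. Both errors vanish after division by
  \<open>sqrt n\<close>. The martingale differences are reversed: \<open>transfer m x = 0\<close>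
  says that \<open>m\<close> averages to zero over the two preimages of \<open>x\<close>, so
  \<open>m\<close> is orthogonal to every periodic function of \<open>2 * x\<close>. Inductions
  therefore peel off the term k = 0. The law of large numbers inside McLeish's argument comes from
  the same decomposition, applied to the centred square of \<open>m\<close>. This is why
  \<open>m\<close> is kept Lipschitz: squaring a bounded Lipschitz function stays in the class. That
  the Fourier hypothesis gives a Lipschitz function rests on uniqueness of Fourier coefficients,
  derived here from Stone-Weierstrass.\<close>

lemma continuous_on_compose_UNIV:
  assumes "continuous_on UNIV f" "continuous_on S g"
  shows "continuous_on S (\<lambda>x. f (g x))"
  using continuous_on_compose2[OF assms] by simp

lemma integrable_on_continuous_UNIV:
  fixes f :: "real \<Rightarrow> 'a::banach"
  assumes "continuous_on UNIV f"
  shows "f integrable_on {a..b}"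
  using integrable_continuous_interval[OF continuous_on_subset[OF assms]] by simp

lemma periodic_of_int:
  fixes f :: "real \<Rightarrow> 'a"
  assumes "\<And>x. f (x + 1) = f x"
  shows "f (x + of_int k) = f x"
proof -
  interpret periodic_fun_simple' f by unfold_locales (rule assms)
  show ?thesis by (rule plus_of_int)
qed

lemma integral_affine:
  fixes f :: "real \<Rightarrow> 'a::banach"
  assumes "continuous_on UNIV f" "m > 0" "a \<le> b"
  shows "integral {a..b} (\<lambda>x. f (m * x + c)) = (1 / m) *\<^sub>R integral {m * a + c..m * b + c} f"
proof -
  have "(f has_integral integral {m * a + c..m * b + c} f) (cbox (m * a + c) (m * b + c))"
    using integrable_on_continuous_UNIV[OF assms(1)] by (simp add: has_integral_integral)
  from has_integral_affinity[OF this, of m c] \<open>m > 0\<close>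
  have "((\<lambda>x. f (m * x + c)) has_integral ((1 / m) *\<^sub>R integral {m * a + c..m * b + c} f))
     ((\<lambda>x. (1 / m) * x + - (1 / m * c)) ` {m * a + c..m * b + c})"
    by simp
  also have "(\<lambda>x. (1 / m) * x + - (1 / m * c)) ` {m * a + c..m * b + c} = {a..b}"
    using assms(2,3) by (subst image_affinity_atLeastAtMost) (auto simp: field_simps mult_left_mono)
  finally show ?thesis by (rule integral_unique)
qed

lemma integral_periodic_shift:
  fixes f :: "real \<Rightarrow> 'a::banach"
  assumes "continuous_on UNIV f" and per: "\<And>x. f (x + 1) = f x"
  shows "integral {0..1} (\<lambda>x. f (x + a)) = integral {0..1} f"
proof -
  define r where "r = frac a"
  have r: "0 \<le> r" "r < 1" by (auto simp: r_def frac_lt_1)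
  have eq: "f (x + a) = f (x + r)" for x
    using periodic_of_int[of f, OF per, of "x + r" "\<lfloor>a\<rfloor>"]
    by (simp add: r_def frac_def algebra_simps)
  have "integral {0..1} (\<lambda>x. f (x + a)) = integral {r..r+1} f"
    using integral_affine[OF assms(1), of 1 0 1 r] by (simp add: eq add.commute)
  also have "\<dots> = integral {r..1} f + integral {1..r+1} f"
    using r by (intro Henstock_Kurzweil_Integration.integral_combine[symmetric] integrable_on_continuous_UNIV assms) auto
  also have "integral {1..r+1} f = integral {0..r} f"
    using integral_affine[OF assms(1), of 1 0 r 1] r by (simp add: per)
  also have "integral {r..1} f + integral {0..r} f = integral {0..1} f"
    using r by (subst add.commute)
      (intro Henstock_Kurzweil_Integration.integral_combine integrable_on_continuous_UNIV assms, auto)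
  finally show ?thesis .
qed

text \<open>\<open>x / 2\<close> and \<open>(x + 1) / 2\<close> are the two preimages of
  \<open>x\<close> under doubling; each half of the unit interval is rescaled onto the whole. Every
  later orthogonality argument averages over this pair.\<close>

lemma integral_unit_halves:
  fixes f :: "real \<Rightarrow> 'a::banach"
  assumes "continuous_on UNIV f"
  shows "integral {0..1} f = integral {0..1} (\<lambda>x. (1/2) *\<^sub>R (f (x / 2) + f ((x + 1) / 2)))"
proof -
  have "integral {0..1} f = integral {0..1/2} f + integral {1/2..1} f"
    by (intro Henstock_Kurzweil_Integration.integral_combine[symmetric] integrable_on_continuous_UNIV assms) auto
  also have "integral {0..1/2} f = (1/2) *\<^sub>R integral {0..1} (\<lambda>x. f (x/2))"
    using integral_affine[OF assms, of "1/2" 0 1 0] by simp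
  also have "integral {1/2..1} f = (1/2) *\<^sub>R integral {0..1} (\<lambda>x. f ((x+1)/2))"
    using integral_affine[OF assms, of "1/2" 0 1 "1/2"] by (simp add: add_divide_distrib)
  also have "(1/2) *\<^sub>R integral {0..1} (\<lambda>x. f (x/2)) + (1/2) *\<^sub>R integral {0..1} (\<lambda>x. f ((x+1)/2))
    = integral {0..1} (\<lambda>x. (1/2) *\<^sub>R (f (x / 2) + f ((x + 1) / 2)))"
    unfolding scaleR_add_right [symmetric]
    by (subst Henstock_Kurzweil_Integration.integral_cmul, subst Henstock_Kurzweil_Integration.integral_add)
       (auto intro!: integrable_on_continuous_UNIV continuous_intros continuous_on_compose_UNIV[OF assms])
  finally show ?thesis .
qed

lemma integral_doubling:
  fixes f :: "real \<Rightarrow> 'a::banach"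
  assumes "continuous_on UNIV f" and per: "\<And>x. f (x + 1) = f x"
  shows "integral {0..1} (\<lambda>x. f (2 * x)) = integral {0..1} f"
  by (subst integral_unit_halves)
     (auto intro!: continuous_intros continuous_on_compose_UNIV[OF assms(1)] simp: per add_divide_distrib simp flip: scaleR_2)

text \<open>The transfer operator of the doubling map for Lebesgue measure, that is, conditional
  expectation given \<open>2 * x\<close>, written as a function of that value.\<close>

definition transfer :: "(real \<Rightarrow> real) \<Rightarrow> real \<Rightarrow> real" where
  "transfer f x = (f (x / 2) + f ((x + 1) / 2)) / 2"

text \<open>A shift of \<open>x\<close> by 1 exchanges the two preimages modulo 1.\<close>

lemma transfer_periodic:
  assumes "\<And>x. f (x + 1) = f x"
  shows "transfer f (x + 1) = transfer f x"
  using assms[of "x / 2"] by (simp add: transfer_def add_divide_distrib add.commute)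

text \<open>Both inverse branches contract by 1/2. This factor makes the iterates of
  \<open>transfer\<close> on a mean-zero function decay geometrically.\<close>

lemma transfer_lipschitz:
  assumes "L-lipschitz_on UNIV f"
  shows "(L / 2)-lipschitz_on UNIV (transfer f)"
proof (rule lipschitz_onI)
  fix x y :: real
  define d where "d = L / 2 * \<bar>x - y\<bar>"
  have "\<bar>f (x / 2) - f (y / 2)\<bar> \<le> d" "\<bar>f ((x + 1) / 2) - f ((y + 1) / 2)\<bar> \<le> d"
    using lipschitz_onD[OF assms, of "x / 2" "y / 2"] lipschitz_onD[OF assms, of "(x + 1) / 2" "(y + 1) / 2"]
    by (auto simp: d_def dist_real_def simp flip: diff_divide_distrib)
  moreover have "\<bar>(p + r) / 2 - (q + s) / 2\<bar> \<le> d"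
    if "\<bar>p - q\<bar> \<le> d" "\<bar>r - s\<bar> \<le> d" for p q r s
    using that unfolding add_divide_distrib by linarith
  ultimately have "\<bar>transfer f x - transfer f y\<bar> \<le> d" unfolding transfer_def by blast
  then show "dist (transfer f x) (transfer f y) \<le> L / 2 * dist x y"
    by (simp add: dist_real_def d_def)
qed (use lipschitz_on_nonneg[OF assms] in auto)

lemma integral_transfer:
  assumes "continuous_on UNIV f"
  shows "integral {0..1} (transfer f) = integral {0..1} f"
  by (subst integral_unit_halves[OF assms]) (simp add: transfer_def[abs_def])

text \<open>Since translates of \<open>f\<close> have mean zero, \<open>f x\<close> is the mean over
  \<open>y\<close> in the unit interval of \<open>f x - f (y + x)\<close>. This turns decay of
  Lipschitz constants into decay of sup norms.\<close>

lemma lipschitz_mean_zero_bound: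
  fixes f :: "real \<Rightarrow> real"
  assumes lip: "L-lipschitz_on UNIV f" and per: "\<And>x. f (x + 1) = f x"
    and zero: "integral {0..1} f = 0"
  shows "\<bar>f x\<bar> \<le> L"
proof -
  have cont: "continuous_on UNIV f" by (rule lipschitz_on_continuous_on[OF lip])
  have "integral {0..1} (\<lambda>y. f x - f (y + x)) = f x - integral {0..1} (\<lambda>y. f (y + x))"
    by (subst Henstock_Kurzweil_Integration.integral_diff)
       (auto intro!: integrable_on_continuous_UNIV continuous_intros continuous_on_compose_UNIV[OF cont])
  also have "\<dots> = f x" by (simp add: integral_periodic_shift[OF cont per] zero)
  finally have "\<bar>f x\<bar> = norm (integral {0..1} (\<lambda>y. f x - f (y + x)))" by simp
  also have "\<dots> \<le> L * (1 - 0)"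
  proof (rule integral_bound)
    fix y :: real assume y: "y \<in> {0..1}"
    have "norm (f x - f (y + x)) \<le> L * \<bar>y\<bar>"
      using lipschitz_onD[OF lip, of x "y + x"] by (simp add: dist_real_def)
    also have "\<dots> \<le> L * 1" using y lipschitz_on_nonneg[OF lip] by (intro mult_left_mono) auto
    finally show "norm (f x - f (y + x)) \<le> L" by simp
  qed (auto intro!: continuous_intros continuous_on_compose_UNIV[OF cont])
  finally show ?thesis by simp
qed

text \<open>Gordin's decomposition: with \<open>u = (\<Sum>k\<ge>1. transfer\<^sup>k f)\<close> one has
  \<open>transfer (f + u) = u\<close>, so \<open>f\<close> is cohomologous to a reversed martingale difference.\<close>

lemma gordin_decomposition:
  fixes f :: "real \<Rightarrow> real"
  assumes lip: "L-lipschitz_on UNIV f" and per: "\<And>x. f (x + 1) = f x"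
    and zero: "integral {0..1} f = 0"
  obtains m u where "\<And>x. f x = m x - u x + u (2 * x)" "(4 * L)-lipschitz_on UNIV m"
    "\<And>x. m (x + 1) = m x" "\<And>x. transfer m x = 0"
    "continuous_on UNIV u" "\<And>x. u (x + 1) = u x" "\<And>x. \<bar>u x\<bar> \<le> L"
proof -
  define g where "g k = (transfer ^^ k) f" for k
  have g_Suc: "g (Suc k) = transfer (g k)" for k by (simp add: g_def)
  have g_lip: "(L / 2 ^ k)-lipschitz_on UNIV (g k)" for k
  proof (induction k)
    case (Suc k)
    have "(L / 2 ^ k / 2)-lipschitz_on UNIV (g (Suc k))"
      unfolding g_Suc by (rule transfer_lipschitz[OF Suc])
    then show ?case by (simp add: field_simps)
  qed (simp add: g_def lip)
  have g_per: "g k (x + 1) = g k x" for k x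
  proof (induction k arbitrary: x)
    case (Suc k)
    show ?case unfolding g_Suc by (rule transfer_periodic[of "g k", OF Suc])
  qed (simp add: g_def per)
  have g_zero: "integral {0..1} (g k) = 0" for k
  proof (induction k)
    case (Suc k)
    show ?case unfolding g_Suc
      by (simp add: integral_transfer[OF lipschitz_on_continuous_on[OF g_lip]] Suc)
  qed (simp add: g_def zero)
  have g_bound: "\<bar>g k x\<bar> \<le> L / 2 ^ k" for k x
    by (rule lipschitz_mean_zero_bound[OF g_lip g_per g_zero])
  define u where "u x = (\<Sum>k. g (Suc k) x)" for x
  \<comment> \<open>The series for \<open>u\<close> starts at the first iterate, so its geometric
    bounds sum to exactly \<open>L\<close>, both for the sup norm and for the Lipschitz
    constant.\<close>
  have geo: "(\<lambda>k. c / 2 ^ Suc k) sums c" for c :: real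
    using sums_mult[OF power_half_series, of c] by (simp add: power_divide)
  have summ: "summable (\<lambda>k. g (Suc k) x)" for x
    by (rule summable_comparison_test[OF _ sums_summable[OF geo[of L]]])
       (auto simp del: power_Suc intro!: exI[of _ 0] g_bound)
  have u_bound: "\<bar>u x\<bar> \<le> L" for x
  proof -
    have "norm (u x) \<le> (\<Sum>k. L / 2 ^ Suc k)" unfolding u_def
      by (rule norm_suminf_le[OF _ sums_summable[OF geo[of L]]])
         (use g_bound in \<open>auto simp del: power_Suc\<close>)
    then show ?thesis by (simp add: sums_unique[OF geo, symmetric] del: power_Suc)
  qed
  have u_lip: "L-lipschitz_on UNIV u"
  proof (rule lipschitz_onI)
    fix x y :: real
    have "norm (u x - u y) = norm (\<Sum>k. g (Suc k) x - g (Suc k) y)"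
      unfolding u_def by (subst suminf_diff[OF summ summ]) simp
    also have "\<dots> \<le> (\<Sum>k. L * \<bar>x - y\<bar> / 2 ^ Suc k)"
      by (rule norm_suminf_le[OF _ sums_summable[OF geo]])
         (use lipschitz_onD[OF g_lip, of x y] in \<open>auto simp del: power_Suc simp: dist_real_def\<close>)
    finally show "dist (u x) (u y) \<le> L * dist x y"
      by (simp add: sums_unique[OF geo, symmetric] dist_real_def del: power_Suc)
  qed (rule lipschitz_on_nonneg[OF lip])
  have u_per: "u (x + 1) = u x" for x by (simp add: u_def g_per)
  \<comment> \<open>Applying \<open>transfer\<close> termwise shifts the series by one index;
    \<open>transfer f\<close> is the missing head.\<close>
  have transfer_u: "transfer f x + transfer u x = u x" for x
  proof -
    have "transfer u x = (\<Sum>k. g (Suc (Suc k)) x)"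
      unfolding transfer_def u_def g_Suc[of "Suc _"]
      by (subst suminf_add[OF summ summ], subst suminf_divide[OF summable_add[OF summ summ]]) simp
    moreover have "transfer f x = g 1 x" by (simp add: g_def)
    ultimately show ?thesis
      using suminf_split_head[OF summ, of x] by (simp add: u_def)
  qed
  define m where "m x = f x + u x - u (2 * x)" for x
  show ?thesis
  proof (rule that[of m u])
    \<comment> \<open>The constant adds \<open>L\<close> for \<open>f\<close>, \<open>L\<close> for
      \<open>u\<close> and \<open>2 * L\<close> for \<open>u\<close> after doubling.\<close>
    show "(4 * L)-lipschitz_on UNIV m"
    proof (rule lipschitz_onI)
      fix x y :: real
      have "\<bar>f x - f y\<bar> \<le> L * \<bar>x - y\<bar>" "\<bar>u x - u y\<bar> \<le> L * \<bar>x - y\<bar>"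
        using lipschitz_onD[OF lip, of x y] lipschitz_onD[OF u_lip, of x y] by (auto simp: dist_real_def)
      moreover have "\<bar>u (2 * x) - u (2 * y)\<bar> \<le> L * \<bar>2 * (x - y)\<bar>"
        using lipschitz_onD[OF u_lip, of "2 * x" "2 * y"] by (simp add: dist_real_def)
      then have "\<bar>u (2 * x) - u (2 * y)\<bar> \<le> 2 * (L * \<bar>x - y\<bar>)"
        by (simp only: abs_mult)
      ultimately have "\<bar>m x - m y\<bar> \<le> 4 * (L * \<bar>x - y\<bar>)" unfolding m_def by arith
      then show "dist (m x) (m y) \<le> 4 * L * dist x y" by (simp add: dist_real_def)
    qed (use lipschitz_on_nonneg[OF lip] in auto)
    show "m (x + 1) = m x" for x
    proof -
      have "u (2 * (x + 1)) = u (2 * x)"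
        using u_per[of "2 * x + 1"] u_per[of "2 * x"] by (simp add: add.assoc)
      then show ?thesis by (simp add: m_def per u_per)
    qed
    show "transfer m x = 0" for x
    proof -
      have "2 * (x / 2) = x" "2 * ((x + 1) / 2) = x + 1" by auto
      then have "transfer m x = (f (x / 2) + u (x / 2) - u x + (f ((x + 1) / 2) + u ((x + 1) / 2) - u x)) / 2"
        unfolding transfer_def m_def by (simp only: u_per)
      also have "\<dots> = transfer f x + transfer u x - u x"
        unfolding transfer_def by (simp add: add_divide_distrib diff_divide_distrib)
      finally show ?thesis using transfer_u by simp
    qed
  qed (use u_bound u_per lipschitz_on_continuous_on[OF u_lip] in \<open>auto simp: m_def\<close>)
qed

section \<open>Second moments of Birkhoff sums\<close>

definition birkhoff :: "(real \<Rightarrow> real) \<Rightarrow> nat \<Rightarrow> real \<Rightarrow> real" where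
  "birkhoff f n x = (\<Sum>k<n. f (2 ^ k * x))"

lemma periodic_power2:
  fixes f :: "real \<Rightarrow> 'a"
  assumes "\<And>x. f (x + 1) = f x"
  shows "f (2 ^ k * (x + 1)) = f (2 ^ k * x)"
  using periodic_of_int[of f "2 ^ k * x" "2 ^ k", OF assms] by (simp add: algebra_simps)

text \<open>The first term is split off rather than the last, because the rest is then a function of
  \<open>2 * x\<close>, which for periodic \<open>f\<close> takes one value at the two preimages of
  a point.\<close>

lemma birkhoff_Suc: "birkhoff f (Suc n) x = f x + birkhoff f n (2 * x)"
  unfolding birkhoff_def sum.lessThan_Suc_shift by (simp add: mult_ac)

lemma birkhoff_periodic:
  assumes "\<And>x. f (x + 1) = f x"
  shows "birkhoff f n (x + 1) = birkhoff f n x"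
  using periodic_power2[of f, OF assms] by (simp add: birkhoff_def)

lemma continuous_birkhoff:
  assumes "continuous_on UNIV f"
  shows "continuous_on UNIV (birkhoff f n)"
  unfolding birkhoff_def[abs_def]
  by (intro continuous_intros continuous_on_compose_UNIV[OF assms])

text \<open>The terms in \<open>u\<close> telescope. For bounded \<open>u\<close> the sums of
  \<open>f\<close> and \<open>m\<close> thus stay at bounded distance, uniformly in
  \<open>n\<close>.\<close>

lemma birkhoff_coboundary:
  assumes "\<And>x. f x = m x - u x + u (2 * x)"
  shows "birkhoff f n x = birkhoff m n x - u x + u (2 ^ n * x)"
proof (induction n arbitrary: x)
  case (Suc n)
  show ?case by (simp add: birkhoff_Suc Suc assms[of x] mult_ac)
qed (simp add: birkhoff_def)

lemma periodic_continuous_bounded: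
  fixes f :: "real \<Rightarrow> 'a::real_normed_vector"
  assumes "continuous_on UNIV f" "\<And>x. f (x + 1) = f x"
  obtains B where "B > 0" "\<And>x. norm (f x) \<le> B"
proof -
  have "compact (f ` {0..1})"
    by (intro compact_continuous_image continuous_on_subset[OF assms(1)]) auto
  then obtain B where B: "B > 0" "\<And>x. x \<in> {0..1} \<Longrightarrow> norm (f x) \<le> B"
    using compact_imp_bounded[of "f ` {0..1}"] unfolding bounded_pos by auto
  have "norm (f x) \<le> B" for x
    using B(2)[of "frac x"] periodic_of_int[of f "frac x" "\<lfloor>x\<rfloor>", OF assms(2)] frac_lt_1[of x]
    by (simp add: frac_def)
  with B(1) show ?thesis using that by blast
qed

text \<open>Orthogonality: the cross term is \<open>m\<close> times a function of
  \<open>2 * x\<close>. Averaged over the two preimages, the second factor is common and the first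
  sums to zero by \<open>ker\<close>.\<close>

lemma integral_martingale_square:
  assumes "continuous_on UNIV m" and per: "\<And>x. m (x + 1) = m x" and ker: "\<And>x. transfer m x = 0"
  shows "integral {0..1} (\<lambda>x. (birkhoff m n x)\<^sup>2) = n * integral {0..1} (\<lambda>x. (m x)\<^sup>2)"
proof (induction n)
  case (Suc n)
  let ?S = "birkhoff m n"
  note contS = continuous_birkhoff[OF assms(1), of n]
  note cont = continuous_on_compose_UNIV[OF assms(1)] continuous_on_compose_UNIV[OF contS]
  have "integral {0..1} (\<lambda>x. (birkhoff m (Suc n) x)\<^sup>2) =
     integral {0..1} (\<lambda>x. (m x)\<^sup>2 + (?S (2 * x))\<^sup>2 + 2 * (m x * ?S (2 * x)))"
    by (simp add: birkhoff_Suc power2_sum algebra_simps)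
  also have "\<dots> = integral {0..1} (\<lambda>x. (m x)\<^sup>2) + integral {0..1} (\<lambda>x. (?S (2 * x))\<^sup>2)
      + 2 * integral {0..1} (\<lambda>x. m x * ?S (2 * x))"
    by (subst Henstock_Kurzweil_Integration.integral_add;
        (subst Henstock_Kurzweil_Integration.integral_add)?)
       (auto intro!: integrable_on_continuous_UNIV continuous_intros cont)
  also have "integral {0..1} (\<lambda>x. (?S (2 * x))\<^sup>2) = integral {0..1} (\<lambda>x. (?S x)\<^sup>2)"
    by (rule integral_doubling[where f = "\<lambda>x. (?S x)\<^sup>2"])
       (auto intro!: continuous_intros cont simp: birkhoff_periodic[of m, OF per])
  also have "integral {0..1} (\<lambda>x. m x * ?S (2 * x)) = 0"
  proof -
    have "(1/2) *\<^sub>R (m (x / 2) * ?S (2 * (x / 2)) + m ((x + 1) / 2) * ?S (2 * ((x + 1) / 2))) = 0" for x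
    proof -
      have "2 * (x / 2) = x" "2 * ((x + 1) / 2) = x + 1" by auto
      then show ?thesis
        using ker[of x] birkhoff_periodic[of m, OF per, of n x]
        by (simp only:) (simp add: transfer_def flip: distrib_right)
    qed
    then show ?thesis
      by (subst integral_unit_halves) (auto intro!: continuous_intros cont)
  qed
  finally show ?case by (simp add: Suc algebra_simps)
qed (simp add: birkhoff_def)

lemma integral_unit_affine:
  fixes g :: "real \<Rightarrow> real"
  assumes "continuous_on UNIV g"
  shows "integral {0..1} (\<lambda>x. c + d * g x) = c + d * integral {0..1} g"
  by (subst Henstock_Kurzweil_Integration.integral_add)
     (auto intro!: integrable_on_continuous_UNIV continuous_intros continuous_on_compose_UNIV[OF assms])

text \<open>Used with \<open>s = sqrt n\<close> in place of Cauchy-Schwarz: the weight brings a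
  square whose integral is of order n down to order \<open>sqrt n\<close>.\<close>

lemma weighted_young:
  fixes a b s :: real
  assumes "s > 0"
  shows "2 * a * b \<le> (1 / s) * a\<^sup>2 + s * b\<^sup>2"
proof -
  have "(1 / s) * a\<^sup>2 + s * b\<^sup>2 - 2 * a * b = (a - s * b)\<^sup>2 / s"
    using assms by (simp add: field_simps power2_eq_square)
  also have "\<dots> \<ge> 0" using assms by simp
  finally show ?thesis by simp
qed

text \<open>A quantitative law of large numbers in L1: the martingale part has second moment
  \<open>n * V\<close>, and the coboundary adds at most \<open>2 * L\<close>. It is meant for the
  centred square of a martingale difference.\<close>

lemma birkhoff_L1_bound:
  assumes lip: "L-lipschitz_on UNIV f" and per: "\<And>x. f (x + 1) = f x"
    and zero: "integral {0..1} f = 0"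
  obtains C where "C \<ge> 0" "\<And>n. n > 0 \<Longrightarrow> integral {0..1} (\<lambda>x. \<bar>birkhoff f n x\<bar>) \<le> C * sqrt n"
proof -
  obtain m u where mu: "\<And>x. f x = m x - u x + u (2 * x)" "(4 * L)-lipschitz_on UNIV m"
    "\<And>x. m (x + 1) = m x" "\<And>x. transfer m x = 0" and u: "\<And>x. \<bar>u x\<bar> \<le> L"
    using gordin_decomposition[OF lip per zero] by metis
  have contm: "continuous_on UNIV m" by (rule lipschitz_on_continuous_on[OF mu(2)])
  note contS = continuous_birkhoff[OF contm]
  have contf: "continuous_on UNIV f" by (rule lipschitz_on_continuous_on[OF lip])
  define V where "V = integral {0..1} (\<lambda>x. (m x)\<^sup>2)"
  have V0: "V \<ge> 0" unfolding V_def
    by (rule Henstock_Kurzweil_Integration.integral_nonneg)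
       (auto intro!: integrable_on_continuous_UNIV continuous_intros continuous_on_compose_UNIV[OF contm])
  have L0: "L \<ge> 0" by (rule lipschitz_on_nonneg[OF lip])
  show ?thesis
  proof
    show "2 * L + 1 + V \<ge> 0" using L0 V0 by simp
    fix n :: nat assume n: "n > 0"
    then have sq: "sqrt n \<ge> 1" "sqrt n > 0" by auto
    have "\<bar>birkhoff f n x\<bar> \<le> 2 * L + sqrt n + (1 / sqrt n) * (birkhoff m n x)\<^sup>2" for x
    proof -
      have "\<bar>birkhoff m n x\<bar> \<le> sqrt n + (1 / sqrt n) * (birkhoff m n x)\<^sup>2"
        using weighted_young[OF sq(2), of "\<bar>birkhoff m n x\<bar>" 1] by simp
      moreover have "birkhoff f n x = birkhoff m n x - u x + u (2 ^ n * x)"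
        by (rule birkhoff_coboundary[of f m u, OF mu(1)])
      ultimately show ?thesis using u[of x] u[of "2 ^ n * x"] by linarith
    qed
    then have "integral {0..1} (\<lambda>x. \<bar>birkhoff f n x\<bar>) \<le>
        integral {0..1} (\<lambda>x. 2 * L + sqrt n + (1 / sqrt n) * (birkhoff m n x)\<^sup>2)"
      by (intro integral_le integrable_on_continuous_UNIV continuous_intros
            continuous_on_compose_UNIV[OF contS] continuous_on_compose_UNIV[OF continuous_birkhoff[OF contf]]) auto
    also have "\<dots> = 2 * L + sqrt n + (1 / sqrt n) * (n * V)"
      unfolding V_def integral_martingale_square[OF contm mu(3,4), of n, symmetric]
      by (rule integral_unit_affine) (intro continuous_intros continuous_on_compose_UNIV[OF contS])
    also have "(1 / sqrt n) * (n * V) = sqrt n * V"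
      using sq by (simp add: field_simps)
    also have "2 * L + sqrt n + sqrt n * V \<le> (2 * L + 1 + V) * sqrt n"
      using mult_left_mono[OF sq(1), of "2 * L"] L0 by (simp add: algebra_simps)
    finally show "integral {0..1} (\<lambda>x. \<bar>birkhoff f n x\<bar>) \<le> (2 * L + 1 + V) * sqrt n" .
  qed
qed

text \<open>This identifies the asymptotic variance with the second moment of \<open>m\<close>. The
  bounded coboundary \<open>d\<close> enters through its square and a cross term; Young's inequality
  makes the latter of order \<open>sqrt n\<close>, negligible against n.\<close>

lemma birkhoff_variance_limit:
  assumes f: "\<And>x. f x = m x - u x + u (2 * x)"
    and contm: "continuous_on UNIV m" and perm: "\<And>x. m (x + 1) = m x" and ker: "\<And>x. transfer m x = 0"
    and contu: "continuous_on UNIV u" and u: "\<And>x. \<bar>u x\<bar> \<le> L"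
  shows "(\<lambda>n. 1 / real n * integral {0..1} (\<lambda>x. (birkhoff f n x)\<^sup>2))
    \<longlonglongrightarrow> integral {0..1} (\<lambda>x. (m x)\<^sup>2)"
proof -
  define V where "V = integral {0..1} (\<lambda>x. (m x)\<^sup>2)"
  define d where "d n x = u (2 ^ n * x) - u x" for n x
  note contS = continuous_birkhoff[OF contm]
  have contd: "continuous_on UNIV (d n)" for n
    unfolding d_def[abs_def] by (intro continuous_intros continuous_on_compose_UNIV[OF contu])
  note cont = continuous_on_compose_UNIV[OF contS] continuous_on_compose_UNIV[OF contd]
  have S: "birkhoff f n x = birkhoff m n x + d n x" for n x
    unfolding d_def using birkhoff_coboundary[of f m u n x, OF f] by simp
  have d: "\<bar>d n x\<bar> \<le> 2 * L" for n x
    using u[of x] u[of "2 ^ n * x"] by (simp add: d_def)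
  have sqd: "(d n x)\<^sup>2 \<le> 4 * L\<^sup>2" for n x
    using power_mono[OF d[of n x], of 2] by (simp add: power_mult_distrib)
  have bound: "\<bar>1 / real n * integral {0..1} (\<lambda>x. (birkhoff f n x)\<^sup>2) - V\<bar>
      \<le> V / sqrt n + 4 * L\<^sup>2 / sqrt n + 4 * L\<^sup>2 / n" if n: "n > 0" for n
  proof -
    have sq: "sqrt n > 0" using n by simp
    have "integral {0..1} (\<lambda>x. (birkhoff f n x)\<^sup>2) - n * V =
      integral {0..1} (\<lambda>x. (birkhoff f n x)\<^sup>2 - (birkhoff m n x)\<^sup>2)"
      unfolding V_def integral_martingale_square[OF contm perm ker, symmetric] S
      by (rule Henstock_Kurzweil_Integration.integral_diff[symmetric])
         (auto intro!: integrable_on_continuous_UNIV continuous_intros cont)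
    also have "\<bar>\<dots>\<bar> \<le> integral {0..1} (\<lambda>x. (sqrt n * (4 * L\<^sup>2) + 4 * L\<^sup>2) + (1 / sqrt n) * (birkhoff m n x)\<^sup>2)"
    proof (rule integral_norm_bound_integral[where 'a = real, unfolded real_norm_def])
      fix x :: real
      let ?a = "birkhoff m n x" and ?b = "d n x"
      have "2 * \<bar>?a\<bar> * \<bar>?b\<bar> \<le> (1 / sqrt n) * ?a\<^sup>2 + sqrt n * ?b\<^sup>2"
        using weighted_young[OF sq, of "\<bar>?a\<bar>" "\<bar>?b\<bar>"] by simp
      also have "\<dots> \<le> (1 / sqrt n) * ?a\<^sup>2 + sqrt n * (4 * L\<^sup>2)"
        using sqd sq by (intro add_left_mono mult_left_mono) auto
      finally have *: "\<bar>2 * ?a * ?b\<bar> \<le> (1 / sqrt n) * ?a\<^sup>2 + sqrt n * (4 * L\<^sup>2)"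
        by (simp add: abs_mult)
      have "\<bar>(birkhoff f n x)\<^sup>2 - ?a\<^sup>2\<bar> = \<bar>2 * ?a * ?b + ?b\<^sup>2\<bar>"
        by (simp add: S power2_sum)
      also have "\<dots> \<le> \<bar>2 * ?a * ?b\<bar> + ?b\<^sup>2"
        using abs_triangle_ineq[of "2 * ?a * ?b" "?b\<^sup>2"] by simp
      finally show "\<bar>(birkhoff f n x)\<^sup>2 - ?a\<^sup>2\<bar> \<le> (sqrt n * (4 * L\<^sup>2) + 4 * L\<^sup>2) + (1 / sqrt n) * ?a\<^sup>2"
        using * sqd[of n x] by linarith
    qed (use n in \<open>auto intro!: integrable_on_continuous_UNIV continuous_intros cont simp: S\<close>)
    also have "\<dots> = (sqrt n * (4 * L\<^sup>2) + 4 * L\<^sup>2) + (1 / sqrt n) * (n * V)"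
      unfolding V_def integral_martingale_square[OF contm perm ker, of n, symmetric]
      by (rule integral_unit_affine) (intro continuous_intros cont)
    finally have *: "\<bar>integral {0..1} (\<lambda>x. (birkhoff f n x)\<^sup>2) - n * V\<bar> \<le>
       (sqrt n * (4 * L\<^sup>2) + 4 * L\<^sup>2) + (1 / sqrt n) * (n * V)" .
    have "\<bar>1 / real n * integral {0..1} (\<lambda>x. (birkhoff f n x)\<^sup>2) - V\<bar> =
      1 / n * \<bar>integral {0..1} (\<lambda>x. (birkhoff f n x)\<^sup>2) - n * V\<bar>"
    proof -
      have "1 / real n * integral {0..1} (\<lambda>x. (birkhoff f n x)\<^sup>2) - V =
        1 / n * (integral {0..1} (\<lambda>x. (birkhoff f n x)\<^sup>2) - n * V)"
        using n by (simp add: right_diff_distrib)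
      then show ?thesis by (simp only: abs_mult) simp
    qed
    also have "\<dots> \<le> 1 / n * ((sqrt n * (4 * L\<^sup>2) + 4 * L\<^sup>2) + (1 / sqrt n) * (n * V))"
      using * by (intro mult_left_mono) auto
    also have "\<dots> = V / sqrt n + 4 * L\<^sup>2 / sqrt n + 4 * L\<^sup>2 / n"
    proof -
      define s where "s = sqrt n"
      have "s > 0" "real n = s * s" using n by (auto simp: s_def)
      then show ?thesis unfolding s_def[symmetric] by (simp add: field_simps)
    qed
    finally show ?thesis .
  qed
  have "(\<lambda>n. 1 / real n * integral {0..1} (\<lambda>x. (birkhoff f n x)\<^sup>2) - V) \<longlonglongrightarrow> 0"
  proof (rule Lim_null_comparison)
    show "\<forall>\<^sub>F n in sequentially. norm (1 / real n * integral {0..1} (\<lambda>x. (birkhoff f n x)\<^sup>2) - V)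
        \<le> V / sqrt n + 4 * L\<^sup>2 / sqrt n + 4 * L\<^sup>2 / n"
      using bound by (auto intro: eventually_sequentiallyI[of 1])
    show "(\<lambda>n. V / sqrt (real n) + 4 * L\<^sup>2 / sqrt (real n) + 4 * L\<^sup>2 / real n) \<longlonglongrightarrow> 0"
      by real_asymp
  qed
  then show ?thesis unfolding V_def by (simp add: LIM_zero_iff)
qed

section \<open>The central limit theorem for the doubling map\<close>

text \<open>For the upper bound, \<open>1 - s + s\<^sup>2 / 2\<close> times the lower Taylor bound
  \<open>1 + s + s\<^sup>2 / 2\<close> of \<open>exp s\<close> is a square plus 1, hence at least
  1.\<close>

lemma exp_minus_quadratic_bound:
  fixes s :: real
  assumes "0 \<le> s"
  shows "\<bar>exp (- s) - (1 - s)\<bar> \<le> s\<^sup>2 / 2"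
proof -
  have "(1 - s + s\<^sup>2 / 2) * exp s \<ge> (1 - s + s\<^sup>2 / 2) * (1 + s + s\<^sup>2 / 2)"
  proof (rule mult_left_mono)
    have "1 - s + s\<^sup>2 / 2 = ((s - 1)\<^sup>2 + 1) / 2" by (simp add: power2_eq_square field_simps)
    also have "\<dots> \<ge> 0" by simp
    finally show "1 - s + s\<^sup>2 / 2 \<ge> 0" .
  qed (use exp_lower_Taylor_quadratic[OF assms] in simp)
  also have "(1 - s + s\<^sup>2 / 2) * (1 + s + s\<^sup>2 / 2) = 1 + (s\<^sup>2 / 2)\<^sup>2"
    by (simp add: power2_eq_square algebra_simps)
  finally have "(1 - s + s\<^sup>2 / 2) * exp s \<ge> 1" using zero_le_power2[of "s\<^sup>2 / 2"] by linarith
  then have "exp (- s) \<le> 1 - s + s\<^sup>2 / 2" by (simp add: exp_minus field_simps)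
  moreover have "exp (- s) \<ge> 1 - s" using exp_ge_add_one_self[of "- s"] by simp
  ultimately show ?thesis by linarith
qed

text \<open>The two expressions agree to second order. The error consists of the Taylor remainder of
  \<open>iexp\<close>, the cubic term left by multiplying out, and the remainder \<open>r\<close> of
  the real exponential; the coefficients 1/6, 1/2 and 1/4 sum to less than 1.\<close>

lemma iexp_martingale_bound:
  fixes a :: real
  assumes "\<bar>a\<bar> \<le> 1"
  shows "cmod (iexp a - (1 + \<i> * a) * exp (- a\<^sup>2 / 2)) \<le> \<bar>a\<bar> ^ 3"
proof -
  define r where "r = exp (- a\<^sup>2 / 2) - (1 - a\<^sup>2 / 2)"
  have r: "\<bar>r\<bar> \<le> (a\<^sup>2 / 2)\<^sup>2 / 2"
    using exp_minus_quadratic_bound[of "a\<^sup>2 / 2"] by (simp add: r_def)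
  have eq: "iexp a - (1 + \<i> * a) * exp (- a\<^sup>2 / 2) =
    (iexp a - (1 + \<i> * a - a\<^sup>2 / 2)) + \<i> * (a ^ 3 / 2) - (1 + \<i> * a) * r"
    by (simp add: r_def algebra_simps power2_eq_square power3_eq_cube flip: of_real_exp)
  have "cmod (iexp a - (1 + \<i> * a - a\<^sup>2 / 2)) \<le> \<bar>a\<bar> ^ 3 / 6"
    using iexp_approx1[of a 2]
    by (simp add: numeral_2_eq_2 power_mult_distrib algebra_simps fact_reduce power3_eq_cube)
  moreover have "cmod (\<i> * (a ^ 3 / 2)) = \<bar>a\<bar> ^ 3 / 2"
    by (simp add: norm_mult norm_divide norm_power)
  moreover have "cmod ((1 + \<i> * a) * r) \<le> \<bar>a\<bar> ^ 3 / 4"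
  proof -
    have "cmod (1 + \<i> * a) \<le> 1 + \<bar>a\<bar>"
      using norm_triangle_ineq[of 1 "\<i> * a"] by (simp add: norm_mult)
    also have "\<dots> \<le> 2" using assms by simp
    finally have "cmod ((1 + \<i> * a) * r) \<le> 2 * ((a\<^sup>2 / 2)\<^sup>2 / 2)"
      unfolding norm_mult using r by (intro mult_mono) auto
    also have "\<dots> = \<bar>a\<bar> ^ 3 * \<bar>a\<bar> / 4"
      by (simp add: power2_eq_square power3_eq_cube)
    also have "\<dots> \<le> \<bar>a\<bar> ^ 3 * 1 / 4" using assms by (intro divide_right_mono mult_left_mono) auto
    finally show ?thesis by simp
  qed
  ultimately have "cmod (iexp a - (1 + \<i> * a) * exp (- a\<^sup>2 / 2)) \<le> \<bar>a\<bar> ^ 3 / 6 + \<bar>a\<bar> ^ 3 / 2 + \<bar>a\<bar> ^ 3 / 4"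
    unfolding eq by (smt (verit) norm_triangle_ineq norm_triangle_ineq4)
  also have "\<dots> \<le> \<bar>a\<bar> ^ 3" by simp
  finally show ?thesis .
qed

text \<open>Consequently the factors \<open>(1 + \<i> * a) * exp (- a\<^sup>2 / 2)\<close> lie in
  the closed unit disc, so products of them can be compared factor by factor.\<close>

lemma cmod_one_plus_i_le: "cmod (1 + \<i> * a) \<le> exp (a\<^sup>2 / 2)"
proof -
  have "(cmod (1 + \<i> * a))\<^sup>2 = 1 + a\<^sup>2" by (simp add: cmod_power2)
  also have "\<dots> \<le> exp (a\<^sup>2)" by (rule exp_ge_add_one_self)
  also have "\<dots> = (exp (a\<^sup>2 / 2))\<^sup>2" by (simp flip: exp_of_nat_mult add: power2_eq_square exp_add[symmetric])
  finally show ?thesis by (rule power2_le_imp_le) simp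
qed

lemma exp_minus_lipschitz:
  fixes a b :: real
  assumes "0 \<le> a" "0 \<le> b"
  shows "\<bar>exp (- a) - exp (- b)\<bar> \<le> \<bar>a - b\<bar>"
proof (cases "a \<le> b")
  case True
  have "exp (- a) - exp (- b) = exp (- a) * (1 - exp (- (b - a)))" by (simp add: algebra_simps flip: exp_add)
  also have "\<dots> \<le> 1 * (b - a)"
    using True assms exp_ge_add_one_self[of "a - b"]
    by (intro mult_mono) (auto simp del: exp_ge_add_one_self)
  finally show ?thesis using True by simp
next
  case False
  have "exp (- b) - exp (- a) = exp (- b) * (1 - exp (- (a - b)))" by (simp add: algebra_simps flip: exp_add)
  also have "\<dots> \<le> 1 * (a - b)"
    using False assms exp_ge_add_one_self[of "b - a"]
    by (intro mult_mono) (auto simp del: exp_ge_add_one_self)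
  finally show ?thesis using False by simp
qed

text \<open>The factor k = 0 averages to \<open>1 + c * transfer m x\<close>, which is 1, over the
  two preimages of \<open>x\<close>, where the other factors agree. Peeling it off leaves the
  product for \<open>n\<close> factors.\<close>

lemma integral_martingale_product:
  fixes c :: complex
  assumes "continuous_on UNIV m" and per: "\<And>x. m (x + 1) = m x" and ker: "\<And>x. transfer m x = 0"
  shows "integral {0..1} (\<lambda>x. \<Prod>k<n. 1 + c * m (2 ^ k * x)) = 1"
proof (induction n)
  case (Suc n)
  define Q where "Q x = (\<Prod>k<n. 1 + c * m (2 ^ k * x))" for x
  have contQ: "continuous_on UNIV Q"
    unfolding Q_def[abs_def] by (intro continuous_intros continuous_on_compose_UNIV[OF assms(1)])
  have perQ: "Q (x + 1) = Q x" for x unfolding Q_def periodic_power2[of m, OF per] ..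
  have "(1/2) *\<^sub>R ((1 + c * m (x / 2)) * Q (2 * (x / 2)) + (1 + c * m ((x + 1) / 2)) * Q (2 * ((x + 1) / 2))) = Q x" for x
  proof -
    have "2 * (x / 2) = x" "2 * ((x + 1) / 2) = x + 1" by auto
    then have "(1/2) *\<^sub>R ((1 + c * m (x / 2)) * Q (2 * (x / 2)) + (1 + c * m ((x + 1) / 2)) * Q (2 * ((x + 1) / 2)))
      = (1 + c * transfer m x) * Q x"
      by (simp only: perQ) (simp add: transfer_def scaleR_conv_of_real field_simps)
    then show ?thesis by (simp add: ker)
  qed
  then have "integral {0..1} (\<lambda>x. (1 + c * m x) * Q (2 * x)) = integral {0..1} Q"
    by (subst integral_unit_halves)
       (auto intro!: continuous_intros continuous_on_compose_UNIV[OF assms(1)] continuous_on_compose_UNIV[OF contQ])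
  also have "(\<lambda>x. (1 + c * m x) * Q (2 * x)) = (\<lambda>x. \<Prod>k<Suc n. 1 + c * m (2 ^ k * x))"
    unfolding prod.lessThan_Suc_shift Q_def by (simp add: mult_ac)
  finally show ?case using Suc unfolding Q_def by simp
qed simp

text \<open>The deterministic core of McLeish's argument. Replacing each exponential by its
  martingale factor costs \<open>b ^ 3\<close>; replacing the random \<open>W\<close> by the
  constant \<open>w\<close> costs \<open>\<bar>W - w\<bar>\<close> times a bound for the product.
  With \<open>b\<close> of order \<open>1 / sqrt n\<close> the first error tends to zero and the
  factor \<open>exp (n * b\<^sup>2 / 2)\<close> stays bounded.\<close>

lemma martingale_char_pointwise:
  fixes a :: "nat \<Rightarrow> real"
  assumes a: "\<And>k. k < n \<Longrightarrow> \<bar>a k\<bar> \<le> b" and b: "b \<le> 1" and w: "0 \<le> w"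
    and W: "W = (\<Sum>k<n. (a k)\<^sup>2 / 2)"
  shows "cmod (iexp (\<Sum>k<n. a k) - (\<Prod>k<n. 1 + \<i> * a k) * complex_of_real (exp (- w)))
    \<le> n * b ^ 3 + exp (n * b\<^sup>2 / 2) * \<bar>W - w\<bar>"
proof -
  define Q where "Q = (\<Prod>k<n. 1 + \<i> * a k)"
  have W0: "W \<ge> 0" unfolding W by (intro sum_nonneg) auto
  have "W \<le> (\<Sum>k<n. b\<^sup>2 / 2)"
    unfolding W using a by (intro sum_mono divide_right_mono abs_le_square_iff[THEN iffD1]) force+
  then have Wle: "W \<le> n * b\<^sup>2 / 2" by simp
  have "cmod Q \<le> (\<Prod>k<n. exp ((a k)\<^sup>2 / 2))"
    unfolding Q_def prod_norm[symmetric] by (intro prod_mono) (auto intro: cmod_one_plus_i_le)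
  also have "\<dots> = exp W" by (simp add: W exp_sum)
  finally have Q: "cmod Q \<le> exp W" .
  have "iexp (\<Sum>k<n. a k) = (\<Prod>k<n. iexp (a k))"
    by (simp add: exp_sum sum_distrib_left)
  moreover have "Q * complex_of_real (exp (- W)) = (\<Prod>k<n. (1 + \<i> * a k) * exp (- (a k)\<^sup>2 / 2))"
    unfolding Q_def W prod.distrib by (simp add: exp_sum flip: sum_negf)
  ultimately have "cmod (iexp (\<Sum>k<n. a k) - Q * complex_of_real (exp (- W))) \<le>
      (\<Sum>k<n. cmod (iexp (a k) - (1 + \<i> * a k) * exp (- (a k)\<^sup>2 / 2)))"
  proof (simp only:, intro norm_prod_diff)
    \<comment> \<open>\<open>norm_prod_diff\<close> bounds a difference of products by the sum of
      the differences, provided that all factors have norm at most 1.\<close>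
    fix k
    have "cmod ((1 + \<i> * a k) * exp (- (a k)\<^sup>2 / 2)) \<le> exp ((a k)\<^sup>2 / 2) * exp (- (a k)\<^sup>2 / 2)"
      unfolding norm_mult by (intro mult_mono cmod_one_plus_i_le) auto
    then show "cmod ((1 + \<i> * a k) * exp (- (a k)\<^sup>2 / 2)) \<le> 1"
      by (simp flip: exp_add)
  qed auto
  also have "\<dots> \<le> (\<Sum>k<n. b ^ 3)"
  proof (intro sum_mono)
    fix k assume "k \<in> {..<n}"
    then have "\<bar>a k\<bar> \<le> b" using a by simp
    then show "cmod (iexp (a k) - (1 + \<i> * a k) * exp (- (a k)\<^sup>2 / 2)) \<le> b ^ 3"
      using iexp_martingale_bound[of "a k"] b power_mono[of "\<bar>a k\<bar>" b 3] by linarith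
  qed
  finally have 1: "cmod (iexp (\<Sum>k<n. a k) - Q * complex_of_real (exp (- W))) \<le> n * b ^ 3" by simp
  have "cmod (Q * complex_of_real (exp (- W)) - Q * complex_of_real (exp (- w))) = cmod Q * \<bar>exp (- W) - exp (- w)\<bar>"
    unfolding right_diff_distrib[symmetric] norm_mult of_real_diff[symmetric] norm_of_real ..
  also have "\<dots> \<le> exp (n * b\<^sup>2 / 2) * \<bar>W - w\<bar>"
    using Q Wle W0 w by (intro mult_mono exp_minus_lipschitz) (auto intro: order_trans[OF Q])
  finally show ?thesis
    using 1 norm_triangle_ineq[of "iexp (\<Sum>k<n. a k) - Q * complex_of_real (exp (- W))" "Q * complex_of_real (exp (- W)) - Q * complex_of_real (exp (- w))"]
    by (simp add: Q_def)
qed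

text \<open>McLeish's argument: the products \<open>\<Prod>k<n. 1 + \<i> \<theta> m(2\<^sup>k x) / sqrt n\<close> have mean one, and
  multiplying by the factors \<open>exp (- \<theta>\<^sup>2 m(2\<^sup>k x)\<^sup>2 / (2 n))\<close>, whose product is nearly constant by
  the law of large numbers, turns them into exponentials.\<close>

lemma martingale_char_limit:
  assumes lip: "K-lipschitz_on UNIV m" and per: "\<And>x. m (x + 1) = m x" and ker: "\<And>x. transfer m x = 0"
  shows "(\<lambda>n. integral {0..1} (\<lambda>x. iexp (\<theta> * (birkhoff m n x / sqrt n))))
    \<longlonglongrightarrow> complex_of_real (exp (- (\<theta>\<^sup>2 * integral {0..1} (\<lambda>x. (m x)\<^sup>2) / 2)))"
proof -
  define V where "V = integral {0..1} (\<lambda>x. (m x)\<^sup>2)"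
  define w where "w = \<theta>\<^sup>2 * V / 2"
  have cont: "continuous_on UNIV m" by (rule lipschitz_on_continuous_on[OF lip])
  note contm = continuous_on_compose_UNIV[OF cont]
  have V0: "V \<ge> 0" unfolding V_def
    by (rule Henstock_Kurzweil_Integration.integral_nonneg)
       (auto intro!: integrable_on_continuous_UNIV continuous_intros contm)
  then have w0: "w \<ge> 0" by (simp add: w_def)
  obtain B where B: "B > 0" "\<And>x. \<bar>m x\<bar> \<le> B"
    using periodic_continuous_bounded[OF cont per] by (auto simp: real_norm_def)
  \<comment> \<open>The centred square is again Lipschitz, periodic and of mean zero, so
    \<open>birkhoff_L1_bound\<close> applies to it and controls the fluctuation of the sum of
    squares.\<close>
  define g where "g x = (m x)\<^sup>2 - V" for x
  have contg: "continuous_on UNIV g"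
    unfolding g_def[abs_def] by (intro continuous_intros contm)
  have g_lip: "(2 * B * K)-lipschitz_on UNIV g"
  proof (rule lipschitz_onI)
    fix x y :: real
    have "\<bar>g x - g y\<bar> = \<bar>m x + m y\<bar> * \<bar>m x - m y\<bar>"
      by (simp add: g_def power2_eq_square algebra_simps flip: abs_mult)
    also have "\<dots> \<le> (2 * B) * (K * \<bar>x - y\<bar>)"
      using B(2)[of x] B(2)[of y] lipschitz_onD[OF lip, of x y] B(1)
      by (intro mult_mono) (auto simp: dist_real_def)
    finally show "dist (g x) (g y) \<le> 2 * B * K * dist x y" by (simp add: dist_real_def mult_ac)
  qed (use lipschitz_on_nonneg[OF lip] B in auto)
  have g_per: "g (x + 1) = g x" for x by (simp add: g_def per)
  have g_zero: "integral {0..1} g = 0"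
    unfolding g_def[abs_def]
    by (subst Henstock_Kurzweil_Integration.integral_diff)
       (auto intro!: integrable_on_continuous_UNIV continuous_intros contm simp: V_def)
  obtain C where C: "C \<ge> 0" "\<And>n. n > 0 \<Longrightarrow> integral {0..1} (\<lambda>x. \<bar>birkhoff g n x\<bar>) \<le> C * sqrt n"
    using birkhoff_L1_bound[OF g_lip g_per g_zero] by metis
  note cont_birk = continuous_on_compose_UNIV[OF continuous_birkhoff[OF cont]]
    continuous_on_compose_UNIV[OF continuous_birkhoff[OF contg]]
  \<comment> \<open>A uniform bound for the normalised summands; \<open>M\<close> is
    \<open>exp (n * (b n)\<^sup>2 / 2)\<close>, which for positive \<open>n\<close> does not depend
    on \<open>n\<close>.\<close>
  define b where "b n = \<bar>\<theta>\<bar> * B / sqrt n" for n :: nat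
  define M where "M = exp (\<theta>\<^sup>2 * B\<^sup>2 / 2)"
  define I where "I n = integral {0..1} (\<lambda>x. iexp (\<theta> * (birkhoff m n x / sqrt n)))" for n
  have bound: "cmod (I n - complex_of_real (exp (- w))) \<le> n * b n ^ 3 + M * (\<theta>\<^sup>2 / (2 * real n) * (C * sqrt n))"
    if n: "n > 0" and b1: "b n \<le> 1" for n
  proof -
    define a where "a x k = \<theta> / sqrt n * m (2 ^ k * x)" for x k
    define Q where "Q x = (\<Prod>k<n. 1 + (\<i> * (\<theta> / sqrt n)) * m (2 ^ k * x))" for x
    have contQ: "continuous_on UNIV Q"
      unfolding Q_def[abs_def] by (intro continuous_intros contm)
    have "integral {0..1} Q = 1"
      unfolding Q_def[abs_def] by (rule integral_martingale_product[OF cont per ker])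
    then have intQ: "integral {0..1} (\<lambda>x. Q x * complex_of_real (exp (- w))) = complex_of_real (exp (- w))"
      by simp
    have pointwise: "cmod (iexp (\<theta> * (birkhoff m n x / sqrt n)) - Q x * complex_of_real (exp (- w))) \<le>
        n * b n ^ 3 + M * (\<theta>\<^sup>2 / (2 * real n)) * \<bar>birkhoff g n x\<bar>" for x
    proof -
      have "(\<Sum>k<n. (a x k)\<^sup>2 / 2) - w = \<theta>\<^sup>2 / (2 * real n) * birkhoff g n x"
        using n unfolding a_def birkhoff_def g_def w_def
        by (simp add: sum_subtractf power_mult_distrib power_divide sum_distrib_left sum_divide_distrib algebra_simps)
      then have W: "\<bar>(\<Sum>k<n. (a x k)\<^sup>2 / 2) - w\<bar> = \<theta>\<^sup>2 / (2 * real n) * \<bar>birkhoff g n x\<bar>"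
        by (simp add: abs_mult)
      have ab: "\<bar>a x k\<bar> \<le> b n" for k
        using B(2)[of "2 ^ k * x"]
        by (auto simp: a_def b_def abs_mult intro!: divide_right_mono mult_left_mono)
      have nb: "n * (b n)\<^sup>2 / 2 = \<theta>\<^sup>2 * B\<^sup>2 / 2"
        using n by (simp add: b_def power_divide power_mult_distrib)
      have S: "(\<Sum>k<n. a x k) = \<theta> * (birkhoff m n x / sqrt n)"
        by (simp add: a_def birkhoff_def sum_distrib_left sum_divide_distrib)
      have P: "(\<Prod>k<n. 1 + \<i> * a x k) = Q x"
        by (simp add: Q_def a_def mult.assoc)
      show ?thesis
        using martingale_char_pointwise[where a = "a x" and n = n and b = "b n" and w = w, OF ab b1 w0 refl]
        unfolding W S P nb M_def by (simp add: mult_ac)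
    qed
    have "I n - integral {0..1} (\<lambda>x. Q x * complex_of_real (exp (- w))) =
        integral {0..1} (\<lambda>x. iexp (\<theta> * (birkhoff m n x / sqrt n)) - Q x * complex_of_real (exp (- w)))"
      unfolding I_def using n
      by (intro Henstock_Kurzweil_Integration.integral_diff[symmetric] integrable_on_continuous_UNIV
            continuous_intros cont_birk continuous_on_compose_UNIV[OF contQ]) auto
    also have "cmod \<dots> \<le> integral {0..1} (\<lambda>x. n * b n ^ 3 + M * (\<theta>\<^sup>2 / (2 * real n)) * \<bar>birkhoff g n x\<bar>)"
      using n pointwise by (intro integral_norm_bound_integral integrable_on_continuous_UNIV
            continuous_intros cont_birk continuous_on_compose_UNIV[OF contQ]) auto
    also have "\<dots> = n * b n ^ 3 + M * (\<theta>\<^sup>2 / (2 * real n)) * integral {0..1} (\<lambda>x. \<bar>birkhoff g n x\<bar>)"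
      by (intro integral_unit_affine continuous_intros cont_birk)
    also have "\<dots> \<le> n * b n ^ 3 + M * (\<theta>\<^sup>2 / (2 * real n)) * (C * sqrt n)"
      using C(2)[OF n] by (intro add_left_mono mult_left_mono) (auto simp: M_def)
    finally show ?thesis unfolding intQ by (simp add: mult_ac)
  qed
  have "(\<lambda>n. b n) \<longlonglongrightarrow> 0" unfolding b_def by real_asymp
  then have "\<forall>\<^sub>F n in sequentially. b n < 1" by (rule order_tendstoD(2)) simp
  then have "\<forall>\<^sub>F n in sequentially. norm (I n - complex_of_real (exp (- w))) \<le> n * b n ^ 3 + M * (\<theta>\<^sup>2 / (2 * real n) * (C * sqrt n))"
    using eventually_gt_at_top[of 0] by eventually_elim (use bound in auto)
  moreover have "(\<lambda>n. n * b n ^ 3 + M * (\<theta>\<^sup>2 / (2 * real n) * (C * sqrt n))) \<longlonglongrightarrow> 0"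
  proof -
    have "(\<lambda>n. real n * (1 / sqrt n) ^ 3) \<longlonglongrightarrow> 0" "(\<lambda>n. sqrt n / n) \<longlonglongrightarrow> 0"
      by real_asymp+
    then have "(\<lambda>n. (\<bar>\<theta>\<bar> * B) ^ 3 * (real n * (1 / sqrt n) ^ 3) + M * \<theta>\<^sup>2 * C / 2 * (sqrt n / n)) \<longlonglongrightarrow> 0"
      by (intro tendsto_add_zero tendsto_mult_right_zero)
    then show ?thesis by (simp add: b_def power_divide mult_ac)
  qed
  ultimately have "(\<lambda>n. I n - complex_of_real (exp (- w))) \<longlonglongrightarrow> 0" by (rule Lim_null_comparison)
  then show ?thesis unfolding I_def w_def V_def by (simp add: LIM_zero_iff)
qed

lemma cmod_iexp_diff_le: "cmod (iexp a - iexp b) \<le> \<bar>a - b\<bar>"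
proof -
  have "iexp a - iexp b = iexp b * (iexp (a - b) - 1)"
    by (simp add: algebra_simps flip: exp_add)
  then have "cmod (iexp a - iexp b) = cmod (iexp (a - b) - 1)"
    by (simp add: norm_mult)
  also have "\<dots> \<le> \<bar>a - b\<bar>" using iexp_approx1[of "a - b" 0] by simp
  finally show ?thesis .
qed

section \<open>Lebesgue integrals on the circle, Borel and completed, and Henstock-Kurzweil
  integrals\<close>

abbreviation unit_lborel :: "real measure" where
  "unit_lborel \<equiv> restrict_space lborel {0..<1}"

lemma prob_space_unit_lborel: "prob_space unit_lborel"
  by (rule prob_spaceI) (simp add: space_restrict_space emeasure_restrict_space)

text \<open>\<open>lebesgue\<close> is the completion of \<open>lborel\<close>, so Borel functions
  have the same integral. The Borel version is the one used for product measures and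
  distributions.\<close>

lemma circle_integral_eq_lborel:
  fixes f :: "real \<Rightarrow> 'a::{banach, second_countable_topology}"
  assumes "f \<in> borel_measurable borel"
  shows "(LINT x|circle_measure. f x) = (LINT x|unit_lborel. f x)"
proof -
  have "(LINT x|circle_measure. f x) = (LINT x|lebesgue. indicator {0..<1} x *\<^sub>R f x)"
    by (rule integral_restrict_space) simp
  also have "\<dots> = (LINT x|lborel. indicator {0..<1} x *\<^sub>R f x)"
    using assms by (intro integral_completion) simp
  also have "\<dots> = (LINT x|unit_lborel. f x)"
    by (rule integral_restrict_space[symmetric]) simp
  finally show ?thesis .
qed

lemma unit_lborel_integral_eq:
  fixes f :: "real \<Rightarrow> 'a::euclidean_space"
  assumes meas: "f \<in> borel_measurable borel" and bound: "\<And>x. x \<in> {0..<1} \<Longrightarrow> norm (f x) \<le> B"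
  shows "(LINT x|unit_lborel. f x) = integral {0..1} f"
proof -
  interpret prob_space unit_lborel by (rule prob_space_unit_lborel)
  have "integrable unit_lborel f"
    using meas by (intro integrable_const_bound[where B = B] AE_I2 bound)
      (auto simp: space_restrict_space intro: measurable_restrict_space1)
  then have "set_integrable lborel {0..<1} f"
    by (subst (asm) integrable_restrict_space) (auto simp: set_integrable_def)
  from set_borel_integral_eq_integral(2)[OF this]
  have "(LINT x|unit_lborel. f x) = integral {0..<1} f"
    by (subst integral_restrict_space) (auto simp: set_lebesgue_integral_def)
  also have "\<dots> = integral {0..1} f"
    by (rule integral_spike_set) (auto intro: negligible_subset[of "{1}"])
  finally show ?thesis .
qed

lemma circle_integral_continuous:
  fixes f :: "real \<Rightarrow> 'a::euclidean_space"
  assumes "continuous_on UNIV f"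
  shows "(LINT x|circle_measure. f x) = integral {0..1} f"
proof -
  have "compact (f ` {0..1})"
    by (intro compact_continuous_image continuous_on_subset[OF assms]) auto
  then obtain B where "\<And>x. x \<in> {0..1} \<Longrightarrow> norm (f x) \<le> B"
    using compact_imp_bounded[of "f ` {0..1}"] unfolding bounded_iff by (metis imageI)
  then show ?thesis
    using borel_measurable_continuous_onI[OF assms]
    by (subst circle_integral_eq_lborel, simp, intro unit_lborel_integral_eq[where B = B]) auto
qed

lemma circle_L2_norm_birkhoff:
  assumes "continuous_on UNIV f"
  shows "(circle_L2_norm (\<lambda>x. \<Sum>k<n. f (2 ^ k * x)))\<^sup>2 = integral {0..1} (\<lambda>x. (birkhoff f n x)\<^sup>2)"
proof -
  have "integral {0..1} (\<lambda>x. (birkhoff f n x)\<^sup>2) \<ge> 0"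
    by (rule Henstock_Kurzweil_Integration.integral_nonneg)
       (auto intro!: integrable_on_continuous_UNIV continuous_intros continuous_on_compose_UNIV[OF continuous_birkhoff[OF assms]])
  then show ?thesis
    unfolding circle_L2_norm_def birkhoff_def[symmetric]
    by (subst circle_integral_continuous)
       (auto intro!: continuous_intros continuous_on_compose_UNIV[OF continuous_birkhoff[OF assms]])
qed

text \<open>Nonnegativity is not automatic, since \<open>asymp_sd\<close> is the root of a
  \<open>lim\<close> that means something only once convergence is known. The characteristic
  functions follow those of the martingale part, because the coboundary is at most
  \<open>2 * L\<close> before division by \<open>sqrt n\<close>.\<close>

theorem doubling_map_clt:
  fixes f :: "real \<Rightarrow> real"
  assumes lip: "L-lipschitz_on UNIV f" and per: "\<And>x. f (x + 1) = f x"
    and zero: "integral {0..1} f = 0"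
  shows "0 \<le> asymp_sd f"
    and "(\<lambda>n. integral {0..1} (\<lambda>x. iexp (\<theta> * (birkhoff f n x / sqrt n))))
      \<longlonglongrightarrow> complex_of_real (exp (- ((\<theta> * asymp_sd f)\<^sup>2 / 2)))"
proof -
  obtain m u where mu: "\<And>x. f x = m x - u x + u (2 * x)" "(4 * L)-lipschitz_on UNIV m"
    "\<And>x. m (x + 1) = m x" "\<And>x. transfer m x = 0"
    "continuous_on UNIV u" and u: "\<And>x. \<bar>u x\<bar> \<le> L"
    using gordin_decomposition[OF lip per zero] by metis
  have contf: "continuous_on UNIV f" by (rule lipschitz_on_continuous_on[OF lip])
  have contm: "continuous_on UNIV m" by (rule lipschitz_on_continuous_on[OF mu(2)])
  define V where "V = integral {0..1} (\<lambda>x. (m x)\<^sup>2)"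
  have V0: "V \<ge> 0" unfolding V_def
    by (rule Henstock_Kurzweil_Integration.integral_nonneg)
       (auto intro!: integrable_on_continuous_UNIV continuous_intros continuous_on_compose_UNIV[OF contm])
  have "(\<lambda>n. 1 / real n * integral {0..1} (\<lambda>x. (birkhoff f n x)\<^sup>2)) \<longlonglongrightarrow> V"
    unfolding V_def by (rule birkhoff_variance_limit[OF mu(1) contm mu(3-5) u])
  then have sd: "asymp_sd f = sqrt V"
    unfolding asymp_sd_def circle_L2_norm_birkhoff[OF contf] by (simp add: limI)
  then show "0 \<le> asymp_sd f" using V0 by simp
  define I where "I g n = integral {0..1} (\<lambda>x. iexp (\<theta> * (birkhoff g n x / sqrt n)))" for g n
  have "(\<lambda>n. I m n) \<longlonglongrightarrow> complex_of_real (exp (- ((\<theta> * asymp_sd f)\<^sup>2 / 2)))"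
    using martingale_char_limit[OF mu(2-4), of \<theta>] V0
    unfolding I_def V_def[symmetric] sd by (simp add: power_mult_distrib)
  moreover have "(\<lambda>n. I f n - I m n) \<longlonglongrightarrow> 0"
  proof (rule Lim_null_comparison)
    have "norm (I f n - I m n) \<le> \<bar>\<theta>\<bar> * (2 * L) / sqrt n" if n: "n > 0" for n
    proof -
      note cont = continuous_on_compose_UNIV[OF continuous_birkhoff[OF contm]]
        continuous_on_compose_UNIV[OF continuous_birkhoff[OF contf]]
      have "I f n - I m n = integral {0..1} (\<lambda>x. iexp (\<theta> * (birkhoff f n x / sqrt n)) - iexp (\<theta> * (birkhoff m n x / sqrt n)))"
        unfolding I_def using n
        by (intro Henstock_Kurzweil_Integration.integral_diff[symmetric] integrable_on_continuous_UNIV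
            continuous_intros cont) auto
      also have "norm \<dots> \<le> (\<bar>\<theta>\<bar> * (2 * L) / sqrt n) * (1 - 0)"
      proof (rule integral_bound)
        fix x :: real
        have "birkhoff f n x = birkhoff m n x - u x + u (2 ^ n * x)"
          by (rule birkhoff_coboundary[of f m u, OF mu(1)])
        then have d: "\<bar>birkhoff f n x - birkhoff m n x\<bar> \<le> 2 * L"
          using u[of x] u[of "2 ^ n * x"] by simp
        have "\<bar>\<theta> * (birkhoff f n x / sqrt n) - \<theta> * (birkhoff m n x / sqrt n)\<bar>
          = \<bar>\<theta>\<bar> * \<bar>birkhoff f n x - birkhoff m n x\<bar> / sqrt n"
          by (simp add: abs_mult flip: right_diff_distrib diff_divide_distrib)
        also have "\<dots> \<le> \<bar>\<theta>\<bar> * (2 * L) / sqrt n"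
          using d by (intro divide_right_mono mult_left_mono) auto
        finally show "norm (iexp (\<theta> * (birkhoff f n x / sqrt n)) - iexp (\<theta> * (birkhoff m n x / sqrt n)))
            \<le> \<bar>\<theta>\<bar> * (2 * L) / sqrt n"
          by (rule order_trans[OF cmod_iexp_diff_le])
      qed (use n in \<open>auto intro!: continuous_intros cont\<close>)
      finally show ?thesis by simp
    qed
    then show "\<forall>\<^sub>F n in sequentially. norm (I f n - I m n) \<le> \<bar>\<theta>\<bar> * (2 * L) / sqrt n"
      by (auto intro: eventually_sequentiallyI[of 1])
    show "(\<lambda>n. \<bar>\<theta>\<bar> * (2 * L) / sqrt (real n)) \<longlonglongrightarrow> 0" by real_asymp
  qed
  ultimately have "(\<lambda>n. I m n + (I f n - I m n)) \<longlonglongrightarrow> complex_of_real (exp (- ((\<theta> * asymp_sd f)\<^sup>2 / 2))) + 0"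
    by (rule tendsto_add)
  then show "(\<lambda>n. integral {0..1} (\<lambda>x. iexp (\<theta> * (birkhoff f n x / sqrt n))))
      \<longlonglongrightarrow> complex_of_real (exp (- ((\<theta> * asymp_sd f)\<^sup>2 / 2)))"
    unfolding I_def by simp
qed

section \<open>Decoupling \<open>x\<close> from \<open>2\<^sup>k x\<close>\<close>

lemma translate_lipschitz:
  assumes "L-lipschitz_on UNIV f"
  shows "L-lipschitz_on UNIV (translate f a)"
  using lipschitz_onD[OF assms, of "_ + a" "_ + a"] lipschitz_on_nonneg[OF assms]
  by (intro lipschitz_onI) (auto simp: translate_def)

lemma translate_periodic:
  assumes "\<And>x. f (x + 1) = f x"
  shows "translate f a (x + 1) = translate f a x"
  using assms[of "x + a"] by (simp add: translate_def add_ac)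

lemma birkhoff_translate: "birkhoff (translate f a) n x = (\<Sum>k<n. f (2 ^ k * x + a))"
  by (simp add: birkhoff_def translate_def)

text \<open>Translating \<open>x\<close> by a dyadic rational \<open>a = j / 2\<^sup>m\<close> turns \<open>2\<^sup>k x - x\<close> into
  \<open>2\<^sup>k x - x - a\<close> modulo 1 as soon as \<open>k \<ge> m\<close>.\<close>

lemma decoupling_bound:
  fixes f :: "real \<Rightarrow> real"
  assumes lip: "L-lipschitz_on UNIV f" and per: "\<And>x. f (x + 1) = f x" and B: "\<And>x. \<bar>f x\<bar> \<le> B"
    and n: "n > 0"
  shows "cmod (integral {0..1} (\<lambda>x. iexp (\<theta> * ((\<Sum>k<n. f (2 ^ k * x - x)) / sqrt n))) -
      integral {0..1} (\<lambda>x. iexp (\<theta> * ((\<Sum>k<n. f (2 ^ k * x - x + a)) / sqrt n))))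
    \<le> \<bar>\<theta>\<bar> * (2 * B * m + n * (L / 2 ^ m)) / sqrt n"
proof -
  have cont: "continuous_on UNIV f" by (rule lipschitz_on_continuous_on[OF lip])
  note contf = continuous_on_compose_UNIV[OF cont]
  \<comment> \<open>An arbitrary shift \<open>a\<close> is rounded down to the dyadic
    \<open>a'\<close>; the Lipschitz bound pays for the rounding.\<close>
  define j where "j = \<lfloor>a * 2 ^ m\<rfloor>"
  define a' :: real where "a' = of_int j / 2 ^ m"
  have j: "of_int j \<le> a * 2 ^ m" "a * 2 ^ m \<le> of_int j + 1" by (auto simp: j_def)
  have a': "\<bar>a' - a\<bar> \<le> 1 / 2 ^ m"
  proof -
    have "a' \<le> a" using j(1) by (simp add: a'_def field_simps)
    moreover have "a \<le> (of_int j + 1) / 2 ^ m" using j(2) by (simp add: pos_le_divide_eq)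
    then have "a \<le> a' + 1 / 2 ^ m" by (simp add: a'_def add_divide_distrib)
    ultimately show ?thesis by linarith
  qed
  have B0: "B \<ge> 0" using B[of 0] by linarith
  have L0: "L \<ge> 0" by (rule lipschitz_on_nonneg[OF lip])
  define S where "S x = (\<Sum>k<n. f (2 ^ k * x - x))" for x
  define S' where "S' x = (\<Sum>k<n. f (2 ^ k * x - x + a))" for x
  have contS: "continuous_on UNIV S" and contS': "continuous_on UNIV S'"
    unfolding S_def[abs_def] S'_def[abs_def] by (intro continuous_intros contf)+
  have perS: "S (x + 1) = S x" for x
  proof -
    have "f (2 ^ k * (x + 1) - (x + 1)) = f (2 ^ k * x - x)" for k
      using periodic_of_int[of f "2 ^ k * x - x" "2 ^ k - 1", OF per] by (simp add: algebra_simps)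
    then show ?thesis by (simp add: S_def)
  qed
  \<comment> \<open>For \<open>k < m\<close> only boundedness is available. For
    \<open>k \<ge> m\<close> the number \<open>2 ^ k * a'\<close> is an integer, which leaves
    \<open>+ a'\<close> from the subtracted \<open>x + - a'\<close> and then the rounding
    error.\<close>
  have term_le: "\<bar>f (2 ^ k * (x + - a') - (x + - a')) - f (2 ^ k * x - x + a)\<bar> \<le>
      (if k < m then 2 * B else 0) + L / 2 ^ m" for k x
  proof (cases "k < m")
    case True
    have "\<bar>f (2 ^ k * (x + - a') - (x + - a')) - f (2 ^ k * x - x + a)\<bar> \<le> 2 * B"
      using B[of "2 ^ k * (x + - a') - (x + - a')"] B[of "2 ^ k * x - x + a"] by linarith
    then show ?thesis using True L0 by (simp add: add_increasing2)
  next
    case False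
    then have "(2::real) ^ k = 2 ^ (k - m) * 2 ^ m" by (simp flip: power_add)
    then have "2 ^ k * a' = of_int (j * 2 ^ (k - m))" by (simp add: a'_def)
    then have "2 ^ k * (x + - a') - (x + - a') = (2 ^ k * x - x + a') + of_int (- (j * 2 ^ (k - m)))"
      by (simp add: algebra_simps)
    then have "f (2 ^ k * (x + - a') - (x + - a')) = f (2 ^ k * x - x + a')"
      by (simp only: periodic_of_int[of f, OF per])
    moreover have "\<bar>f (2 ^ k * x - x + a') - f (2 ^ k * x - x + a)\<bar> \<le> L * \<bar>a' - a\<bar>"
      using lipschitz_onD[OF lip, of "2 ^ k * x - x + a'" "2 ^ k * x - x + a"] by (simp add: dist_real_def)
    moreover have "L * \<bar>a' - a\<bar> \<le> L * (1 / 2 ^ m)"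
      using a' L0 by (rule mult_left_mono)
    ultimately show ?thesis using False by simp
  qed
  have diff: "\<bar>S (x + - a') - S' x\<bar> \<le> 2 * B * m + n * (L / 2 ^ m)" for x
  proof -
    have "\<bar>S (x + - a') - S' x\<bar> \<le> (\<Sum>k<n. (if k < m then 2 * B else 0) + L / 2 ^ m)"
      unfolding S_def S'_def sum_subtractf[symmetric]
      by (rule order_trans[OF sum_abs sum_mono[OF term_le]])
    also have "\<dots> = (\<Sum>k<n. if k < m then 2 * B else 0) + n * (L / 2 ^ m)"
      by (simp add: sum.distrib)
    also have "(\<Sum>k<n. if k < m then 2 * B else 0) \<le> (\<Sum>k<m. 2 * B)"
    proof -
      have "(\<Sum>k<n. if k < m then 2 * B else 0) = (\<Sum>k\<in>{..<n} \<inter> {..<m}. 2 * B)"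
        by (subst sum.inter_restrict) (auto intro!: sum.cong)
      also have "\<dots> \<le> (\<Sum>k<m. 2 * B)" using B0 by (intro sum_mono2) auto
      finally show ?thesis .
    qed
    finally show ?thesis by (simp add: mult.commute[of "real m"])
  qed
  have "integral {0..1} (\<lambda>x. iexp (\<theta> * (S x / sqrt n))) = integral {0..1} (\<lambda>x. iexp (\<theta> * (S (x + - a') / sqrt n)))"
    by (rule integral_periodic_shift[symmetric, where f = "\<lambda>x. iexp (\<theta> * (S x / sqrt n))"])
       (use n in \<open>auto intro!: continuous_intros continuous_on_compose_UNIV[OF contS] simp: perS\<close>)
  then have "integral {0..1} (\<lambda>x. iexp (\<theta> * (S x / sqrt n))) - integral {0..1} (\<lambda>x. iexp (\<theta> * (S' x / sqrt n))) =
      integral {0..1} (\<lambda>x. iexp (\<theta> * (S (x + - a') / sqrt n)) - iexp (\<theta> * (S' x / sqrt n)))"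
    using n by (simp only:, intro Henstock_Kurzweil_Integration.integral_diff[symmetric] integrable_on_continuous_UNIV
      continuous_intros continuous_on_compose_UNIV[OF contS] continuous_on_compose_UNIV[OF contS']) auto
  also have "cmod \<dots> \<le> (\<bar>\<theta>\<bar> * (2 * B * m + n * (L / 2 ^ m)) / sqrt n) * (1 - 0)"
  proof (rule integral_bound)
    fix x :: real
    have "\<bar>\<theta> * (S (x + - a') / sqrt n) - \<theta> * (S' x / sqrt n)\<bar> = \<bar>\<theta>\<bar> * \<bar>S (x + - a') - S' x\<bar> / sqrt n"
      by (simp add: abs_mult flip: right_diff_distrib diff_divide_distrib)
    also have "\<dots> \<le> \<bar>\<theta>\<bar> * (2 * B * m + n * (L / 2 ^ m)) / sqrt n"
      using diff[of x] by (intro divide_right_mono mult_left_mono) auto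
    finally show "cmod (iexp (\<theta> * (S (x + - a') / sqrt n)) - iexp (\<theta> * (S' x / sqrt n)))
        \<le> \<bar>\<theta>\<bar> * (2 * B * m + n * (L / 2 ^ m)) / sqrt n"
      by (rule order_trans[OF cmod_iexp_diff_le])
  qed (use n in \<open>auto intro!: continuous_intros continuous_on_compose_UNIV[OF contS] continuous_on_compose_UNIV[OF contS']\<close>)
  finally show ?thesis by (simp add: S_def S'_def)
qed

text \<open>\<open>decoupling_bound\<close> holds for every shift \<open>a\<close>, so it can be
  averaged over \<open>a\<close>. At fixed \<open>x\<close> the subtracted \<open>x\<close> is then
  absorbed into the variable \<open>a\<close> by translation invariance.\<close>

lemma decoupling_limit:
  fixes f :: "real \<Rightarrow> real"
  assumes lip: "L-lipschitz_on UNIV f" and per: "\<And>x. f (x + 1) = f x"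
  shows "(\<lambda>n. integral {0..1} (\<lambda>x. iexp (\<theta> * ((\<Sum>k<n. f (2 ^ k * x - x)) / sqrt n))) -
     integral {0..1} (\<lambda>a. integral {0..1} (\<lambda>x. iexp (\<theta> * (birkhoff (translate f a) n x / sqrt n)))))
    \<longlonglongrightarrow> 0"
proof -
  have cont: "continuous_on UNIV f" by (rule lipschitz_on_continuous_on[OF lip])
  note contf = continuous_on_compose_UNIV[OF cont]
  obtain B where B: "B > 0" "\<And>x. \<bar>f x\<bar> \<le> B"
    using periodic_continuous_bounded[OF cont per] by (auto simp: real_norm_def)
  have L0: "L \<ge> 0" by (rule lipschitz_on_nonneg[OF lip])
  define E where "E n = integral {0..1} (\<lambda>x. iexp (\<theta> * ((\<Sum>k<n. f (2 ^ k * x - x)) / sqrt n)))" for n :: nat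
  define h where "h n a x = iexp (\<theta> * ((\<Sum>k<n. f (2 ^ k * x - x + a)) / sqrt n))" for n a x
  define g where "g n a x = iexp (\<theta> * (birkhoff (translate f a) n x / sqrt n))" for n a x
  have cont_h: "continuous_on S (\<lambda>(a, x). h n a x)" if "n > 0" for n S
    using that unfolding h_def split_beta by (intro continuous_intros contf) auto
  have cont_g: "continuous_on S (\<lambda>(a, x). g n a x)" if "n > 0" for n S
    using that unfolding g_def birkhoff_translate split_beta by (intro continuous_intros contf) auto
  have swap: "integral {0..1} (\<lambda>a. integral {0..1} (h n a)) = integral {0..1} (\<lambda>a. integral {0..1} (g n a))"
    if n: "n > 0" for n
  proof -
    have "integral {0..1} (\<lambda>a. integral {0..1} (h n a)) = integral {0..1} (\<lambda>x. integral {0..1} (\<lambda>a. h n a x))"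
      using integral_swap_continuous[of 0 0 1 1 "h n"] cont_h[OF n] by simp
    also have "(\<lambda>x. integral {0..1} (\<lambda>a. h n a x)) = (\<lambda>x. integral {0..1} (\<lambda>a. g n a x))"
    proof
      fix x :: real
      have hper: "h n (a + 1) x = h n a x" for a
        using per[of "2 ^ _ * x - x + a"] by (simp add: h_def add_ac)
      have hcont: "continuous_on UNIV (\<lambda>a. h n a x)"
        using n unfolding h_def by (intro continuous_intros contf) auto
      have "(\<lambda>a. g n a x) = (\<lambda>a. h n (a + x) x)"
        by (simp add: g_def h_def birkhoff_translate)
      then show "integral {0..1} (\<lambda>a. h n a x) = integral {0..1} (\<lambda>a. g n a x)"
        using integral_periodic_shift[OF hcont hper, of x] by simp
    qed
    also have "integral {0..1} (\<lambda>x. integral {0..1} (\<lambda>a. g n a x)) = integral {0..1} (\<lambda>a. integral {0..1} (g n a))"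
      using integral_swap_continuous[of 0 0 1 1 "g n"] cont_g[OF n] by simp
    finally show ?thesis .
  qed
  \<comment> \<open>This makes \<open>2 ^ m n\<close> at least \<open>n\<close>, so rounding costs
    at most \<open>L\<close> in total, while the early terms cost only about
    \<open>2 * B * log 2 n\<close>; both are small against \<open>sqrt n\<close>.\<close>
  define m where "m n = nat \<lceil>log 2 (real n)\<rceil>" for n :: nat
  have bound: "cmod (E n - integral {0..1} (\<lambda>a. integral {0..1} (g n a)))
      \<le> \<bar>\<theta>\<bar> * (2 * B) * ((log 2 n + 1) / sqrt n) + \<bar>\<theta>\<bar> * L * (1 / sqrt n)" if n: "n > 0" for n
  proof -
    have log0: "log 2 n \<ge> 0" using n by simp
    then have m: "real (m n) \<le> log 2 n + 1" "log 2 n \<le> real (m n)"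
      unfolding m_def by linarith+
    have "real n = 2 powr log 2 n" using n by simp
    also have "\<dots> \<le> 2 powr real (m n)" using m(2) by (intro powr_mono) auto
    finally have nm: "real n \<le> 2 ^ m n" by (simp add: powr_realpow)
    have "continuous_on {0..1} (\<lambda>a. integral (cbox 0 1) (h n a))"
      by (rule integral_continuous_on_param[OF cont_h[OF n]])
    then have "E n - integral {0..1} (\<lambda>a. integral {0..1} (h n a)) = integral {0..1} (\<lambda>a. E n - integral {0..1} (h n a))"
      by (subst Henstock_Kurzweil_Integration.integral_diff)
         (auto intro: integrable_continuous_interval)
    also have "cmod \<dots> \<le> (\<bar>\<theta>\<bar> * (2 * B * m n + n * (L / 2 ^ m n)) / sqrt n) * (1 - 0)"
    proof (rule integral_bound)
      show "continuous_on {0..1} (\<lambda>a. E n - integral {0..1} (h n a))"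
        using \<open>continuous_on {0..1} (\<lambda>a. integral (cbox 0 1) (h n a))\<close>
        by (auto intro!: continuous_intros)
      show "cmod (E n - integral {0..1} (h n a)) \<le> \<bar>\<theta>\<bar> * (2 * B * m n + n * (L / 2 ^ m n)) / sqrt n" for a
        unfolding E_def h_def by (rule decoupling_bound[OF lip per B(2) n])
    qed simp
    also have "\<dots> \<le> (\<bar>\<theta>\<bar> * (2 * B * (log 2 n + 1) + L) / sqrt n) * (1 - 0)"
    proof -
      have "n * (L / 2 ^ m n) \<le> 2 ^ m n * (L / 2 ^ m n)"
        using nm L0 by (intro mult_right_mono) auto
      then show ?thesis using m B
        by (intro mult_right_mono divide_right_mono mult_left_mono add_mono) auto
    qed
    finally show ?thesis unfolding swap[OF n] by (simp add: distrib_left add_divide_distrib mult_ac)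
  qed
  have "(\<lambda>n. E n - integral {0..1} (\<lambda>a. integral {0..1} (g n a))) \<longlonglongrightarrow> 0"
  proof (rule Lim_null_comparison)
    show "\<forall>\<^sub>F n in sequentially. norm (E n - integral {0..1} (\<lambda>a. integral {0..1} (g n a)))
      \<le> \<bar>\<theta>\<bar> * (2 * B) * ((log 2 n + 1) / sqrt n) + \<bar>\<theta>\<bar> * L * (1 / sqrt n)"
      using bound by (auto intro: eventually_sequentiallyI[of 1])
    have "(\<lambda>n. (log 2 (real n) + 1) / sqrt n) \<longlonglongrightarrow> 0" "(\<lambda>n. 1 / sqrt (real n)) \<longlonglongrightarrow> 0"
      by real_asymp+
    then show "(\<lambda>n. \<bar>\<theta>\<bar> * (2 * B) * ((log 2 n + 1) / sqrt n) + \<bar>\<theta>\<bar> * L * (1 / sqrt n)) \<longlonglongrightarrow> 0"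
      by (intro tendsto_add_zero tendsto_mult_right_zero)
  qed
  then show ?thesis unfolding E_def g_def .
qed

section \<open>The limit of the characteristic functions and the measurability of the standard
  deviations\<close>

lemma char_limit:
  fixes f :: "real \<Rightarrow> real"
  assumes lip: "L-lipschitz_on UNIV f" and per: "\<And>x. f (x + 1) = f x"
    and zero: "integral {0..1} f = 0"
  shows "(\<lambda>n. integral {0..1} (\<lambda>x. iexp (\<theta> * ((\<Sum>k<n. f (2 ^ k * x - x)) / sqrt n))))
    \<longlonglongrightarrow> integral {0..1} (\<lambda>a. complex_of_real (exp (- ((\<theta> * asymp_sd (translate f a))\<^sup>2 / 2))))"
proof -
  have cont: "continuous_on UNIV f" by (rule lipschitz_on_continuous_on[OF lip])
  note contf = continuous_on_compose_UNIV[OF cont]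
  define G where "G n a = integral {0..1} (\<lambda>x. iexp (\<theta> * (birkhoff (translate f a) n x / sqrt n)))" for n :: nat and a
  have contG: "continuous_on {0..1} (G n)" for n
  \<comment> \<open>Dominated convergence asks for integrability at every index. At
    \<open>n = 0\<close> the division by \<open>sqrt 0\<close> yields 0, so the integrand is
    constantly 1.\<close>
  proof (cases "n = 0")
    case False
    have "continuous_on {0..1} (\<lambda>a. integral (cbox 0 1) (\<lambda>x. iexp (\<theta> * (birkhoff (translate f a) n x / sqrt n))))"
      using False unfolding birkhoff_translate
      by (intro integral_continuous_on_param) (auto simp: split_beta intro!: continuous_intros contf)
    then show ?thesis by (simp add: G_def[abs_def])
  qed (simp add: G_def[abs_def])
  have transl_zero: "integral {0..1} (translate f a) = 0" for a
    using integral_periodic_shift[OF cont per, of a] zero by (simp add: translate_def[abs_def])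
  have "(\<lambda>n. integral {0..1} (G n)) \<longlonglongrightarrow>
      integral {0..1} (\<lambda>a. complex_of_real (exp (- ((\<theta> * asymp_sd (translate f a))\<^sup>2 / 2))))"
  proof (rule dominated_convergence(2))
    show "G n integrable_on {0..1}" for n by (rule integrable_continuous_interval[OF contG])
    show "norm (G n a) \<le> 1" for n a
    proof (cases "n = 0")
      case False
      have "norm (G n a) \<le> 1 * (1 - 0)" unfolding G_def birkhoff_translate
        by (rule integral_bound) (use False in \<open>auto intro!: continuous_intros contf\<close>)
      then show ?thesis by simp
    qed (simp add: G_def)
    show "(\<lambda>n. G n a) \<longlonglongrightarrow> complex_of_real (exp (- ((\<theta> * asymp_sd (translate f a))\<^sup>2 / 2)))" for a
      unfolding G_def
      by (rule doubling_map_clt(2)[OF translate_lipschitz[OF lip] translate_periodic[of f, OF per] transl_zero])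
  qed auto
  from tendsto_add[OF decoupling_limit[OF lip per, of \<theta>] this] show ?thesis
    unfolding G_def by simp
qed

text \<open>At each \<open>n\<close> the normalised squared norm is continuous in \<open>a\<close>,
  being a parameter integral, and \<open>lim\<close> preserves Borel measurability.\<close>

lemma borel_measurable_asymp_sd:
  assumes "continuous_on UNIV f"
  shows "(\<lambda>a. asymp_sd (translate f a)) \<in> borel_measurable borel"
proof -
  note contf = continuous_on_compose_UNIV[OF assms]
  have "(\<lambda>a. 1 / real n * (circle_L2_norm (\<lambda>x. \<Sum>k<n. translate f a (2 ^ k * x)))\<^sup>2) \<in> borel_measurable borel" for n
  proof -
    have "continuous_on UNIV (translate f a)" for a
      unfolding translate_def[abs_def] by (intro continuous_intros contf)
    then have eq: "(circle_L2_norm (\<lambda>x. \<Sum>k<n. translate f a (2 ^ k * x)))\<^sup>2 =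
        integral (cbox 0 1) (\<lambda>x. (\<Sum>k<n. f (2 ^ k * x + a))\<^sup>2)" for a
      using circle_L2_norm_birkhoff by (simp add: birkhoff_translate)
    show ?thesis unfolding eq
      by (intro borel_measurable_continuous_onI continuous_intros integral_continuous_on_param)
         (auto simp: split_beta intro!: continuous_intros contf)
  qed
  then have "(\<lambda>a. lim (\<lambda>n. 1 / real n * (circle_L2_norm (\<lambda>x. \<Sum>k<n. translate f a (2 ^ k * x)))\<^sup>2))
      \<in> borel_measurable borel"
    by (rule borel_measurable_lim_metric)
  then show ?thesis unfolding asymp_sd_def by measurable
qed

section \<open>Fourier series\<close>

text \<open>Translation by half a period of the integrand, \<open>1 / (2 * k)\<close>, changes its
  sign but not its integral.\<close>

lemma integral_cis_eq_0:
  assumes "k \<noteq> 0"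
  shows "integral {0..1} (\<lambda>x. cis (2 * pi * of_int k * x)) = 0"
proof -
  let ?e = "\<lambda>x. cis (2 * pi * of_int k * x)"
  have cont: "continuous_on UNIV ?e" by (intro continuous_intros)
  have "?e (x + 1) = ?e x" for x
    using cis_mult[of "2 * pi * of_int k * x" "2 * pi * of_int k"] cis_multiple_2pi[of "of_int k"]
    by (simp add: distrib_left)
  then have "integral {0..1} ?e = integral {0..1} (\<lambda>x. ?e (x + 1 / (2 * of_int k)))"
    using integral_periodic_shift[OF cont] by metis
  also have "\<dots> = integral {0..1} (\<lambda>x. - ?e x)"
    using assms by (simp add: distrib_left flip: cis_mult)
  also have "\<dots> = - integral {0..1} ?e" by simp
  finally show ?thesis by simp
qed

text \<open>A real-linear functional restricted to the unit circle is a trigonometric polynomial of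
  frequencies 1 and -1: the base case for real polynomials on the circle.\<close>

lemma bounded_linear_cis:
  fixes g :: "complex \<Rightarrow> real"
  assumes "bounded_linear g"
  shows "complex_of_real (g (cis t)) = (g 1 - \<i> * g \<i>) / 2 * cis t + (g 1 + \<i> * g \<i>) / 2 * cis (- t)"
proof -
  interpret bounded_linear g by fact
  have "cis t = cos t *\<^sub>R 1 + sin t *\<^sub>R \<i>" by (simp add: complex_eq_iff)
  then have "g (cis t) = cos t * g 1 + sin t * g \<i>" by (simp add: add scaleR)
  then show ?thesis by (simp add: complex_eq_iff field_simps)
qed

lemma continuous_on_real_polynomial_cis:
  assumes "real_polynomial_function g"
  shows "continuous_on UNIV (\<lambda>x. g (cis (2 * pi * x)))"
proof -
  have "continuous_on UNIV g"
    using assms by (intro continuous_on_polymonial_function) (simp add: real_polynomial_function_eq)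
  then show ?thesis by (rule continuous_on_compose_UNIV) (intro continuous_intros)
qed

text \<open>The conclusion is preserved by products in \<open>g\<close> because it is quantified over all \<open>k\<close>.\<close>

lemma real_polynomial_orthogonal:
  fixes g :: "complex \<Rightarrow> real" and k :: "real \<Rightarrow> complex"
  assumes "real_polynomial_function g"
    and "continuous_on UNIV k" "\<And>p. integral {0..1} (\<lambda>x. k x * cis (2 * pi * of_int p * x)) = 0"
  shows "integral {0..1} (\<lambda>x. (k x * g (cis (2 * pi * x))) * cis (2 * pi * of_int p * x)) = 0"
  using assms
proof (induction g arbitrary: k p)
  case (linear g)
  note cont = continuous_on_compose_UNIV[OF linear(2)]
  define \<alpha> \<beta> where "\<alpha> = (g 1 - \<i> * g \<i>) / 2" and "\<beta> = (g 1 + \<i> * g \<i>) / 2"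
  \<comment> \<open>Multiplication by a linear functional of \<open>cis (2 * pi * x)\<close> only
    shifts the frequency \<open>p\<close> by one either way, so orthogonality to all frequencies
    survives.\<close>
  have cis_p: "cis (2 * pi * of_int (p + 1) * x) = cis (2 * pi * x) * cis (2 * pi * of_int p * x)"
    "cis (2 * pi * of_int (p - 1) * x) = cis (- (2 * pi * x)) * cis (2 * pi * of_int p * x)" for x
    by (simp_all add: cis_mult algebra_simps)
  have "(k x * g (cis (2 * pi * x))) * cis (2 * pi * of_int p * x) =
      \<alpha> * (k x * cis (2 * pi * of_int (p + 1) * x)) + \<beta> * (k x * cis (2 * pi * of_int (p - 1) * x))" for x
    unfolding bounded_linear_cis[OF linear(1)] \<alpha>_def[symmetric] \<beta>_def[symmetric]
    unfolding cis_p by (simp only: distrib_left distrib_right mult_ac)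
  then have "integral {0..1} (\<lambda>x. (k x * g (cis (2 * pi * x))) * cis (2 * pi * of_int p * x)) =
    \<alpha> * integral {0..1} (\<lambda>x. k x * cis (2 * pi * of_int (p + 1) * x)) +
    \<beta> * integral {0..1} (\<lambda>x. k x * cis (2 * pi * of_int (p - 1) * x))"
    by (simp only:, subst Henstock_Kurzweil_Integration.integral_add)
       (auto intro!: integrable_on_continuous_UNIV continuous_intros cont)
  then show ?case unfolding linear(3) by simp
next
  case (const c)
  have "integral {0..1} (\<lambda>x. (k x * c) * cis (2 * pi * of_int p * x)) =
      c * integral {0..1} (\<lambda>x. k x * cis (2 * pi * of_int p * x))"
    unfolding integral_mult_right[symmetric] by (simp add: mult_ac)
  then show ?case unfolding const(2) by simp
next
  case (add g1 g2)
  note cont = continuous_on_compose_UNIV[OF add(5)]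
  note c = add(1,2)[THEN continuous_on_real_polynomial_cis]
  have "integral {0..1} (\<lambda>x. (k x * (g1 (cis (2 * pi * x)) + g2 (cis (2 * pi * x)))) * cis (2 * pi * of_int p * x)) =
     integral {0..1} (\<lambda>x. (k x * g1 (cis (2 * pi * x))) * cis (2 * pi * of_int p * x)) +
     integral {0..1} (\<lambda>x. (k x * g2 (cis (2 * pi * x))) * cis (2 * pi * of_int p * x))"
    by (subst Henstock_Kurzweil_Integration.integral_add[symmetric])
       (auto intro!: integrable_on_continuous_UNIV continuous_intros cont c simp: distrib_left distrib_right)
  then show ?case using add.IH[OF add(5,6)] by simp
next
  case (mult g1 g2)
  have c: "continuous_on UNIV (\<lambda>x. k x * g1 (cis (2 * pi * x)))"
    by (intro continuous_intros mult(5) continuous_on_real_polynomial_cis mult(1))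
  from mult.IH(2)[OF c mult.IH(1)[OF mult(5,6)]] show ?case by (simp add: mult_ac)
qed

text \<open>\<open>Arg2pi\<close> jumps at 1, so \<open>h'\<close> is not a composition of
  continuous maps. Continuity comes from compactness instead: the preimage of a closed set is the
  image of a compact part of the unit interval, hence closed.\<close>

lemma periodic_factor_circle:
  fixes h :: "real \<Rightarrow> 'a::topological_space"
  assumes "continuous_on UNIV h" and per: "\<And>x. h (x + 1) = h x"
  obtains h' where "continuous_on (sphere 0 1) h'" "\<And>x. h' (cis (2 * pi * x)) = h x"
proof
  define h' where "h' z = h (Arg2pi z / (2 * pi))" for z
  show h'_cis: "h' (cis (2 * pi * x)) = h x" for x
  proof -
    have "cis (2 * pi * x) = cis (Arg2pi (cis (2 * pi * x)))"
      using Arg2pi_eq[of "cis (2 * pi * x)"] by (simp add: cis_conv_exp)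
    then have "sin (Arg2pi (cis (2 * pi * x))) = sin (2 * pi * x) \<and> cos (Arg2pi (cis (2 * pi * x))) = cos (2 * pi * x)"
      by (simp add: complex_eq_iff)
    then obtain n :: int where "Arg2pi (cis (2 * pi * x)) = 2 * pi * x + 2 * pi * n"
      using sin_cos_eq_iff by blast
    then have "Arg2pi (cis (2 * pi * x)) / (2 * pi) = x + of_int n" by (simp add: add_divide_distrib)
    then show ?thesis using periodic_of_int[of h x n, OF per] by (simp add: h'_def)
  qed
  show "continuous_on (sphere 0 1) h'"
    unfolding continuous_on_closed_vimage[OF closed_sphere]
  proof (intro allI impI)
    fix C :: "'a set" assume "closed C"
    have "h' -` C \<inter> sphere 0 1 = (\<lambda>x. cis (2 * pi * x)) ` ({0..1} \<inter> h -` C)"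
    proof (intro equalityI subsetI)
      fix z assume z: "z \<in> h' -` C \<inter> sphere 0 1"
      then have "z = cis (2 * pi * (Arg2pi z / (2 * pi)))"
        using Arg2pi_eq[of z] by (simp add: cis_conv_exp)
      moreover have "Arg2pi z / (2 * pi) \<in> {0..1} \<inter> h -` C"
        using z Arg2pi_ge_0[of z] Arg2pi_lt_2pi[of z] by (auto simp: h'_def divide_le_eq)
      ultimately show "z \<in> (\<lambda>x. cis (2 * pi * x)) ` ({0..1} \<inter> h -` C)" by blast
    qed (auto simp: h'_cis)
    also have "compact \<dots>"
      using \<open>closed C\<close> by (intro compact_continuous_image continuous_intros compact_Int_closed
          closed_vimage assms) auto
    finally show "closed (h' -` C \<inter> sphere 0 1)" by (rule compact_imp_closed)
  qed
qed

text \<open>Stone-Weierstrass approximates \<open>h\<close> itself by some \<open>g\<close> within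
  \<open>e / B\<close>. By orthogonality the integral of the square of \<open>h\<close> equals that
  of \<open>h * (h - g)\<close>, which is at most \<open>B * (e / B)\<close>.\<close>

lemma fourier_uniqueness_real:
  fixes h :: "real \<Rightarrow> real"
  assumes cont: "continuous_on UNIV h" and per: "\<And>x. h (x + 1) = h x"
    and orth: "\<And>g::complex \<Rightarrow> real. real_polynomial_function g \<Longrightarrow> integral {0..1} (\<lambda>x. h x * g (cis (2 * pi * x))) = 0"
  shows "h x = 0"
proof -
  obtain h' where h': "continuous_on (sphere 0 1) h'" "\<And>x. h' (cis (2 * pi * x)) = h x"
    using periodic_factor_circle[OF cont per] by blast
  note conth = continuous_on_compose_UNIV[OF cont]
  obtain B where B: "B > 0" "\<And>x. norm (h x) \<le> B"
    using periodic_continuous_bounded[OF cont per] by blast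
  have sq_nonneg: "integral {0..1} (\<lambda>x. (h x)\<^sup>2) \<ge> 0"
    by (rule Henstock_Kurzweil_Integration.integral_nonneg)
       (auto intro!: integrable_on_continuous_UNIV continuous_intros conth)
  have "integral {0..1} (\<lambda>x. (h x)\<^sup>2) \<le> 0 + e" if "e > 0" for e
  proof -
    obtain g where g: "real_polynomial_function g" "\<And>z. z \<in> sphere 0 1 \<Longrightarrow> \<bar>h' z - g z\<bar> < e / B"
      using Stone_Weierstrass_real_polynomial_function[OF compact_sphere h'(1), of "e / B"] \<open>e > 0\<close> B(1)
      by (auto simp: divide_pos_pos)
    have contg: "continuous_on UNIV (\<lambda>x. g (cis (2 * pi * x)))"
      by (rule continuous_on_real_polynomial_cis[OF g(1)])
    have "integral {0..1} (\<lambda>x. (h x)\<^sup>2) = integral {0..1} (\<lambda>x. (h x)\<^sup>2) - integral {0..1} (\<lambda>x. h x * g (cis (2 * pi * x)))"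
      by (simp add: orth[OF g(1)])
    also have "\<dots> = integral {0..1} (\<lambda>x. h x * (h x - g (cis (2 * pi * x))))"
      by (subst Henstock_Kurzweil_Integration.integral_diff[symmetric])
         (auto intro!: integrable_on_continuous_UNIV continuous_intros conth contg simp: power2_eq_square right_diff_distrib)
    also have "\<dots> \<le> norm \<dots>" by simp
    also have "\<dots> \<le> e * (1 - 0)"
    proof (rule integral_bound)
      fix x :: real
      have "\<bar>h x - g (cis (2 * pi * x))\<bar> \<le> e / B"
        using g(2)[of "cis (2 * pi * x)"] by (simp add: h'(2))
      then have "norm (h x * (h x - g (cis (2 * pi * x)))) \<le> B * (e / B)"
        unfolding norm_mult using B by (intro mult_mono) auto
      then show "norm (h x * (h x - g (cis (2 * pi * x)))) \<le> e" using B(1) by simp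
    qed (auto intro!: continuous_intros conth continuous_on_subset[OF contg])
    finally show ?thesis by simp
  qed
  then have "integral {0..1} (\<lambda>x. (h x)\<^sup>2) \<le> 0" by (rule field_le_epsilon)
  with sq_nonneg have int_zero: "integral {0..1} (\<lambda>x. (h x)\<^sup>2) = 0" by simp
  then have zero: "h x = 0" if "x \<in> {0..1}" for x
  proof -
    have "continuous_on {0..1} (\<lambda>x. (h x)\<^sup>2)" by (intro continuous_intros conth)
    then show ?thesis
      using integral_eq_0_iff[of 0 1 "\<lambda>x. (h x)\<^sup>2"] that int_zero by auto
  qed
  have "h x = h (frac x)"
    using periodic_of_int[of h "frac x" "\<lfloor>x\<rfloor>", OF per] by (simp add: frac_def)
  then show ?thesis using zero[of "frac x"] frac_lt_1[of x] by simp
qed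

text \<open>Real and imaginary parts are treated separately because the approximating polynomials
  are real-valued. In \<open>ortho\<close>, \<open>r\<close> stands for either part, which commutes
  with real factors.\<close>

lemma fourier_uniqueness:
  fixes h :: "real \<Rightarrow> complex"
  assumes cont: "continuous_on UNIV h" and per: "\<And>x. h (x + 1) = h x"
    and orth: "\<And>p. integral {0..1} (\<lambda>x. h x * cis (2 * pi * of_int p * x)) = 0"
  shows "h x = 0"
proof -
  note conth = continuous_on_compose_UNIV[OF cont]
  have ortho: "integral {0..1} (\<lambda>x. r (h x) * g (cis (2 * pi * x))) = 0"
    if g: "real_polynomial_function g" and r: "bounded_linear r"
      and rmult: "\<And>z c. r (z * complex_of_real c) = r z * c" for g and r :: "complex \<Rightarrow> real"
  proof -
    have contg: "continuous_on UNIV (\<lambda>x. g (cis (2 * pi * x)))"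
      by (rule continuous_on_real_polynomial_cis[OF g])
    have "integral {0..1} (r \<circ> (\<lambda>x. h x * g (cis (2 * pi * x)))) = r (integral {0..1} (\<lambda>x. h x * g (cis (2 * pi * x))))"
      by (rule integral_linear[OF _ r]) (intro integrable_on_continuous_UNIV continuous_intros conth contg)
    also have "integral {0..1} (\<lambda>x. h x * g (cis (2 * pi * x))) = 0"
      using real_polynomial_orthogonal[OF g cont orth, of 0] by simp
    finally show ?thesis by (simp add: o_def rmult linear_simps(3)[OF r])
  qed
  have "Re (h x) = 0"
    by (rule fourier_uniqueness_real[of "\<lambda>x. Re (h x)"])
       (auto intro!: continuous_intros cont ortho bounded_linear_Re simp: per)
  moreover have "Im (h x) = 0"
    by (rule fourier_uniqueness_real[of "\<lambda>x. Im (h x)"])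
       (auto intro!: continuous_intros cont ortho bounded_linear_Im simp: per)
  ultimately show ?thesis by (simp add: complex_eq_iff)
qed

text \<open>The symmetric intervals are cofinal among the finite sets of integers. This turns an
  unordered sum into a sequence, as dominated convergence requires.\<close>

lemma has_sum_int_LIMSEQ:
  fixes f :: "int \<Rightarrow> 'a::{comm_monoid_add, topological_space}"
  assumes "(f has_sum S) UNIV"
  shows "(\<lambda>N. \<Sum>p = - int N..int N. f p) \<longlonglongrightarrow> S"
proof -
  have "filterlim (\<lambda>N. {- int N..int N}) (finite_subsets_at_top UNIV) sequentially"
    unfolding filterlim_finite_subsets_at_top
  proof safe
    fix X :: "int set" assume "finite X"
    then have "finite ((\<lambda>p. nat \<bar>p\<bar>) ` X)" by simp
    then obtain N where N: "\<And>p. p \<in> X \<Longrightarrow> nat \<bar>p\<bar> \<le> N"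
      using finite_nat_set_iff_bounded_le by (metis imageI)
    show "\<forall>\<^sub>F n in sequentially. finite {- int n..int n} \<and> X \<subseteq> {- int n..int n} \<and> {- int n..int n} \<subseteq> UNIV"
      using eventually_ge_at_top[of N] by eventually_elim (use N in fastforce)
  qed
  with assms show ?thesis
    unfolding has_sum_def by (rule filterlim_compose)
qed

lemma fourier_coeff_eq_integral:
  assumes "continuous_on UNIV f"
  shows "fourier_coeff f p = integral {0..1} (\<lambda>x. f x * cis (2 * pi * of_int (- p) * x))"
proof -
  have "continuous_on UNIV (\<lambda>x. complex_of_real (f x) * cis (2 * pi * of_int (- p) * x))"
    by (intro continuous_intros assms)
  then show ?thesis
    unfolding fourier_coeff_def by (subst circle_integral_continuous[symmetric]) (simp_all add: cis_conv_exp mult_ac)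
qed

text \<open>The exponential of order \<open>p\<close> has Lipschitz constant
  \<open>2 * pi * \<bar>p\<bar>\<close>, so the partial sums share the constant
  \<open>2 * pi * K\<close> and pass it to their limit \<open>g\<close>. Equality of
  \<open>f\<close> and \<open>g\<close> follows by comparing Fourier coefficients.\<close>

lemma fourier_summable_imp_lipschitz:
  assumes cont: "continuous_on UNIV f" and per: "\<And>x. f (x + 1) = f x"
    and summ: "(\<lambda>p::int. \<bar>real_of_int p\<bar> * cmod (fourier_coeff f p)) summable_on UNIV"
  obtains L where "L-lipschitz_on UNIV f"
proof -
  define c where "c p = fourier_coeff f p" for p
  define e where "e p x = cis (2 * pi * of_int p * x)" for p :: int and x :: real
  have cont_e: "continuous_on S (\<lambda>x. e p x)" for p S unfolding e_def by (intro continuous_intros)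
  have norm_e: "norm (e p x) = 1" for p x by (simp add: e_def)
  have e_mult: "e p x * e q x = e (p + q) x" for p q x by (simp add: e_def cis_mult algebra_simps)
  have e_per: "e p (x + 1) = e p x" for p x
    using cis_mult[of "2 * pi * of_int p * x" "2 * pi * of_int p"] cis_multiple_2pi[of "of_int p"]
    by (simp add: e_def distrib_left)
  define K where "K = (\<Sum>\<^sub>\<infinity>p. \<bar>real_of_int p\<bar> * cmod (c p))"
  define M where "M = (\<Sum>\<^sub>\<infinity>p. cmod (c p))"
  \<comment> \<open>The weight \<open>\<bar>p\<bar>\<close> is at least 1 except at 0, where it
    loses the coefficient; that single term is added back.\<close>
  have summ0: "(\<lambda>p. cmod (c p)) summable_on UNIV"
  proof (rule summable_on_comparison_test)
    show "(\<lambda>p. \<bar>real_of_int p\<bar> * cmod (c p) + (if p = 0 then cmod (c 0) else 0)) summable_on UNIV"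
      by (intro summable_on_add summ[folded c_def] finite_nonzero_values_imp_summable_on) simp
    show "cmod (c p) \<le> \<bar>real_of_int p\<bar> * cmod (c p) + (if p = 0 then cmod (c 0) else 0)" for p
    proof (cases "p = 0")
      case False
      then have "1 * cmod (c p) \<le> \<bar>real_of_int p\<bar> * cmod (c p)" by (intro mult_right_mono) auto
      then show ?thesis using False by simp
    qed simp
  qed simp
  define s where "s N x = (\<Sum>p = - int N..int N. c p * e p x)" for N x
  define g where "g x = (\<Sum>\<^sub>\<infinity>p. c p * e p x)" for x
  have s_lim: "(\<lambda>N. s N x) \<longlonglongrightarrow> g x" for x
  proof -
    have "(\<lambda>p. c p * e p x) summable_on UNIV"
      by (rule abs_summable_summable) (simp add: norm_mult norm_e summ0)
    then show ?thesis unfolding s_def g_def by (intro has_sum_int_LIMSEQ has_sum_infsum)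
  qed
  have s_bound: "norm (s N x) \<le> M" for N x
  proof -
    have "norm (s N x) \<le> (\<Sum>p = - int N..int N. cmod (c p))"
      unfolding s_def by (rule order_trans[OF norm_sum]) (simp add: norm_mult norm_e)
    also have "\<dots> \<le> M" unfolding M_def by (intro finite_sum_le_infsum summ0) auto
    finally show ?thesis .
  qed
  have K0: "K \<ge> 0" unfolding K_def by (intro infsum_nonneg) simp
  have s_lip: "norm (s N x - s N y) \<le> 2 * pi * K * \<bar>x - y\<bar>" for N x y
  proof -
    have "norm (s N x - s N y) \<le> (\<Sum>p = - int N..int N. norm (c p * e p x - c p * e p y))"
      unfolding s_def sum_subtractf[symmetric] by (rule norm_sum)
    also have "\<dots> \<le> (\<Sum>p = - int N..int N. (2 * pi * \<bar>x - y\<bar>) * (\<bar>real_of_int p\<bar> * cmod (c p)))"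
    proof (rule sum_mono)
      fix p
      have "norm (e p x - e p y) \<le> \<bar>2 * pi * of_int p * x - 2 * pi * of_int p * y\<bar>"
        unfolding e_def cis_conv_exp by (rule cmod_iexp_diff_le)
      also have "\<dots> = 2 * pi * \<bar>of_int p\<bar> * \<bar>x - y\<bar>"
        by (simp add: abs_mult flip: right_diff_distrib)
      finally have "cmod (c p) * norm (e p x - e p y) \<le> cmod (c p) * (2 * pi * \<bar>of_int p\<bar> * \<bar>x - y\<bar>)"
        by (rule mult_left_mono) simp
      then show "norm (c p * e p x - c p * e p y) \<le> (2 * pi * \<bar>x - y\<bar>) * (\<bar>real_of_int p\<bar> * cmod (c p))"
        by (simp add: mult_ac flip: norm_mult right_diff_distrib)
    qed
    also have "\<dots> = (2 * pi * \<bar>x - y\<bar>) * (\<Sum>p = - int N..int N. \<bar>real_of_int p\<bar> * cmod (c p))"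
      by (simp add: sum_distrib_left)
    also have "\<dots> \<le> (2 * pi * \<bar>x - y\<bar>) * K"
      unfolding K_def by (intro mult_left_mono finite_sum_le_infsum summ[folded c_def]) auto
    finally show ?thesis by (simp add: mult_ac)
  qed
  have g_lip: "(2 * pi * K)-lipschitz_on UNIV g"
  proof (rule lipschitz_onI)
    show "dist (g x) (g y) \<le> 2 * pi * K * dist x y" for x y
      unfolding dist_norm real_norm_def
      by (rule LIMSEQ_le_const2[OF tendsto_norm[OF tendsto_diff[OF s_lim s_lim]]]) (use s_lip in auto)
  qed (use K0 in simp)
  have cont_g: "continuous_on UNIV g" by (rule lipschitz_on_continuous_on[OF g_lip])
  have g_per: "g (x + 1) = g x" for x by (simp add: g_def e_per)
  have g_coeff: "integral {0..1} (\<lambda>x. g x * e (- q) x) = c q" for q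
  proof -
    have lim: "(\<lambda>N. integral {0..1} (\<lambda>x. s N x * e (- q) x)) \<longlonglongrightarrow> integral {0..1} (\<lambda>x. g x * e (- q) x)"
    proof (rule dominated_convergence(2))
      show "(\<lambda>x. s N x * e (- q) x) integrable_on {0..1}" for N
        unfolding s_def by (intro integrable_on_continuous_UNIV continuous_intros cont_e)
      show "norm (s N x * e (- q) x) \<le> M" for N x
        using s_bound by (simp add: norm_mult norm_e)
      show "(\<lambda>N. s N x * e (- q) x) \<longlonglongrightarrow> g x * e (- q) x" for x
        by (intro tendsto_intros s_lim)
    qed auto
    have ev: "\<forall>\<^sub>F N in sequentially. integral {0..1} (\<lambda>x. s N x * e (- q) x) = c q"
      using eventually_ge_at_top[of "nat \<bar>q\<bar>"]
    proof eventually_elim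
      case (elim N)
      have e_int: "integral {0..1} (\<lambda>x. c p * e (p - q) x) = (if p = q then c p else 0)" for p
        using integral_cis_eq_0[of "p - q"] by (simp add: e_def)
      have "integral {0..1} (\<lambda>x. s N x * e (- q) x) = integral {0..1} (\<lambda>x. \<Sum>p = - int N..int N. c p * e (p - q) x)"
        by (simp add: s_def sum_distrib_right mult.assoc e_mult)
      also have "\<dots> = (\<Sum>p = - int N..int N. integral {0..1} (\<lambda>x. c p * e (p - q) x))"
        by (intro integral_sum) (auto intro!: integrable_on_continuous_UNIV continuous_intros cont_e)
      also have "\<dots> = c q"
      proof -
        have "q \<in> {- int N..int N}" using elim by auto
        then show ?thesis unfolding e_int by simp
      qed
      finally show ?case .
    qed
    show ?thesis by (rule LIMSEQ_unique[OF lim tendsto_eventually[OF ev]])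
  qed
  have "complex_of_real (f x) - g x = 0" for x
  proof (rule fourier_uniqueness[of "\<lambda>x. complex_of_real (f x) - g x"])
    show "continuous_on UNIV (\<lambda>x. complex_of_real (f x) - g x)" by (intro continuous_intros cont cont_g)
    show "integral {0..1} (\<lambda>x. (complex_of_real (f x) - g x) * cis (2 * pi * of_int p * x)) = 0" for p
    proof -
      \<comment> \<open>Testing against the exponential of order \<open>p\<close> reads off the
        coefficient of order \<open>- p\<close>, whence the double negations.\<close>
      have "integral {0..1} (\<lambda>x. (complex_of_real (f x) - g x) * cis (2 * pi * of_int p * x)) =
          integral {0..1} (\<lambda>x. complex_of_real (f x) * cis (2 * pi * of_int (- (- p)) * x)) -
          integral {0..1} (\<lambda>x. g x * e (- (- p)) x)"
        unfolding e_def left_diff_distrib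
        by (subst Henstock_Kurzweil_Integration.integral_diff)
           (auto intro!: integrable_on_continuous_UNIV continuous_intros cont cont_g)
      then show ?thesis unfolding g_coeff fourier_coeff_eq_integral[OF cont, symmetric] c_def by simp
    qed
  qed (simp add: per g_per)
  then have f_eq: "complex_of_real (f x) = g x" for x by simp
  have "(2 * pi * K)-lipschitz_on UNIV f"
  proof (rule lipschitz_onI)
    show "dist (f x) (f y) \<le> 2 * pi * K * dist x y" for x y
      using lipschitz_onD[OF g_lip, of x y] by (simp add: dist_of_real flip: f_eq)
  qed (use K0 in simp)
  then show ?thesis by (rule that)
qed

section \<open>Mixtures of centred Gaussian laws\<close>

text \<open>\<open>gaussian_cdf s\<close> is the distribution function of \<open>s\<close> times a
  standard normal variable. This form covers the Dirac case \<open>s = 0\<close> too, where the set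
  is everything or empty according to the sign of \<open>t\<close>.\<close>

lemma measure_std_normal_le:
  assumes "0 \<le> s"
  shows "measure std_normal_distribution {z. s * z \<le> t} = gaussian_cdf s t"
proof (cases "s = 0")
  case True
  interpret prob_space std_normal_distribution
    by (rule prob_space_normal_density) simp
  show ?thesis using True prob_space by (simp add: gaussian_cdf_def)
next
  case False
  then have s: "s > 0" using assms by simp
  then have "{z. s * z \<le> t} = {..t / s}" by (auto simp: field_simps)
  then have "measure std_normal_distribution {z. s * z \<le> t} = (LINT z|std_normal_distribution. indicator {..t / s} z)"
    by simp
  also have "\<dots> = (LINT z|lborel. std_normal_density z * indicator {..t / s} z)"
    by (subst integral_density) auto
  also have "\<dots> = (LBINT z:{..t / s}. 1 / sqrt (2 * pi) * exp (- z\<^sup>2 / 2))"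
    by (simp add: set_lebesgue_integral_def std_normal_density_def mult_ac)
  also have "\<dots> = gaussian_cdf s t"
    using False by (simp add: gaussian_cdf_def)
  finally show ?thesis .
qed

lemma measure_circle_eq:
  assumes "A \<in> sets borel" "A \<subseteq> {0..<1}"
  shows "measure circle_measure A = measure unit_lborel A"
  using assms by (simp add: measure_restrict_space)

locale gaussian_mixture =
  fixes \<sigma> :: "real \<Rightarrow> real"
  assumes measurable_sd [measurable]: "\<sigma> \<in> borel_measurable borel"
    and sd_nonneg: "\<And>y. 0 \<le> \<sigma> y"
begin

text \<open>The law of \<sigma>(Y) Z with Y uniform on the circle and Z an independent standard
  normal variable. It realises the averaged Gaussian functions as those of a probability measure,
  which Levy's theorem needs as its limit.\<close>

definition mixture :: "real measure" where
  "mixture = distr (unit_lborel \<Otimes>\<^sub>M std_normal_distribution) borel (\<lambda>(y, z). \<sigma> y * z)"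

sublocale pair: pair_prob_space unit_lborel std_normal_distribution
  by (simp add: pair_prob_space_def pair_sigma_finite_def prob_space_unit_lborel
      prob_space_normal_density prob_space_imp_sigma_finite)

lemma measurable_sd_unit_lborel [measurable]: "\<sigma> \<in> borel_measurable unit_lborel"
  by (rule measurable_restrict_space1) simp

lemma real_distribution_mixture: "real_distribution mixture"
  unfolding mixture_def by (rule pair.real_distribution_distr) measurable

lemma integral_mixture:
  fixes F :: "real \<Rightarrow> 'a::{banach, second_countable_topology}"
  assumes [measurable]: "F \<in> borel_measurable borel" and bound: "\<And>x. norm (F x) \<le> B"
  shows "(LINT x|mixture. F x) = (LINT y|unit_lborel. (LINT z|std_normal_distribution. F (\<sigma> y * z)))"
proof -
  have "(LINT x|mixture. F x) = (LINT p|(unit_lborel \<Otimes>\<^sub>M std_normal_distribution). F (case p of (y, z) \<Rightarrow> \<sigma> y * z))"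
    unfolding mixture_def by (rule integral_distr) measurable
  also have "\<dots> = (LINT p|(unit_lborel \<Otimes>\<^sub>M std_normal_distribution). (\<lambda>(y, z). F (\<sigma> y * z)) p)"
    by (simp add: split_beta)
  also have "\<dots> = (LINT y|unit_lborel. (LINT z|std_normal_distribution. F (\<sigma> y * z)))"
  proof (rule pair.integral_fst'[symmetric, of "\<lambda>(y, z). F (\<sigma> y * z)", simplified])
    show "integrable (unit_lborel \<Otimes>\<^sub>M std_normal_distribution) (\<lambda>(y, z). F (\<sigma> y * z))"
      by (rule pair.integrable_const_bound[where B = B]) (auto simp: bound split_beta)
  qed
  finally show ?thesis .
qed

lemma char_mixture:
  "char mixture \<theta> = integral {0..1} (\<lambda>y. complex_of_real (exp (- ((\<theta> * \<sigma> y)\<^sup>2 / 2))))"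
proof -
  have "char mixture \<theta> = (LINT y|unit_lborel. (LINT z|std_normal_distribution. iexp (\<theta> * (\<sigma> y * z))))"
    unfolding char_def by (rule integral_mixture[where B = 1]) auto
  also have "\<dots> = (LINT y|unit_lborel. char std_normal_distribution (\<theta> * \<sigma> y))"
    by (simp add: char_def mult.assoc)
  also have "\<dots> = (LINT y|unit_lborel. complex_of_real (exp (- ((\<theta> * \<sigma> y)\<^sup>2 / 2))))"
    by (simp add: char_std_normal_distribution)
  also have "\<dots> = integral {0..1} (\<lambda>y. complex_of_real (exp (- ((\<theta> * \<sigma> y)\<^sup>2 / 2))))"
    by (rule unit_lborel_integral_eq[where B = 1]) auto
  finally show ?thesis .
qed

lemma cdf_mixture: "cdf mixture t = (LINT y|circle_measure. gaussian_cdf (\<sigma> y) t)"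
proof -
  interpret N: prob_space std_normal_distribution
    by (rule prob_space_normal_density) simp
  have eq: "(LINT z|std_normal_distribution. indicator {..t} (\<sigma> y * z)) = gaussian_cdf (\<sigma> y) t" for y
  proof -
    have "(\<lambda>z. indicator {..t} (\<sigma> y * z) :: real) = indicator {z. \<sigma> y * z \<le> t}"
      by (auto simp: indicator_def)
    then show ?thesis using measure_std_normal_le[OF sd_nonneg] by simp
  qed
  \<comment> \<open>Measurability is read off the parameter integral, which avoids the case
    distinction in \<open>gaussian_cdf\<close>.\<close>
  have [measurable]: "(\<lambda>y. gaussian_cdf (\<sigma> y) t) \<in> borel_measurable borel"
    unfolding eq[symmetric] by measurable
  have "cdf mixture t = (LINT x|mixture. indicator {..t} x)"
    by (simp add: cdf_def mixture_def)
  also have "\<dots> = (LINT y|unit_lborel. (LINT z|std_normal_distribution. indicator {..t} (\<sigma> y * z)))"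
    by (rule integral_mixture[where B = 1]) (auto simp: indicator_def)
  also have "\<dots> = (LINT y|circle_measure. gaussian_cdf (\<sigma> y) t)"
    unfolding eq by (rule circle_integral_eq_lborel[symmetric]) measurable
  finally show ?thesis .
qed

end

theorem theorem1p5:
  fixes \<phi> :: "real \<Rightarrow> real" and t :: real
  assumes periodic: "\<And>x. \<phi> (x + 1) = \<phi> x"
    and continuous: "continuous_on UNIV \<phi>"
    and mean_zero: "(LINT x|circle_measure. \<phi> x) = 0"
    and coeffs: "(\<lambda>p::int. \<bar>real_of_int p\<bar> * cmod (fourier_coeff \<phi> p)) summable_on UNIV"
    and cont_point: "isCont (mixed_gaussian_cdf \<phi>) t"
  shows "(\<lambda>n::nat. measure circle_measure
            {x \<in> space circle_measure. 1 / sqrt (real n) * (\<Sum>k<n. \<phi> (2 ^ k * x - x)) \<le> t})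
         \<longlonglongrightarrow> mixed_gaussian_cdf \<phi> t"
proof -
  obtain L where lip: "L-lipschitz_on UNIV \<phi>"
    using fourier_summable_imp_lipschitz[OF continuous periodic coeffs] by blast
  have zero: "integral {0..1} \<phi> = 0"
    using mean_zero circle_integral_continuous[OF continuous] by simp
  have transl_zero: "integral {0..1} (translate \<phi> a) = 0" for a
    using integral_periodic_shift[OF continuous periodic, of a] zero by (simp add: translate_def[abs_def])
  define X where "X n x = 1 / sqrt (real n) * (\<Sum>k<n. \<phi> (2 ^ k * x - x))" for n x
  have contX: "continuous_on UNIV (X n)" for n
    unfolding X_def[abs_def] by (intro continuous_intros continuous_on_compose_UNIV[OF continuous])
  then have [measurable]: "X n \<in> borel_measurable borel" for n
    by (rule borel_measurable_continuous_onI)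
  then have [measurable]: "X n \<in> borel_measurable unit_lborel" for n
    by (intro measurable_restrict_space1) simp
  interpret prob_space unit_lborel by (rule prob_space_unit_lborel)
  interpret mix: gaussian_mixture "\<lambda>a. asymp_sd (translate \<phi> a)"
    by unfold_locales
       (auto intro: borel_measurable_asymp_sd continuous
          doubling_map_clt(1)[OF translate_lipschitz[OF lip] translate_periodic[of \<phi>, OF periodic] transl_zero])
  have "weak_conv_m (\<lambda>n. distr unit_lborel borel (X n)) mix.mixture"
  proof (rule levy_continuity)
    fix \<theta> :: real
    have "char (distr unit_lborel borel (X n)) \<theta> = integral {0..1} (\<lambda>x. iexp (\<theta> * ((\<Sum>k<n. \<phi> (2 ^ k * x - x)) / sqrt n)))" for n
    proof -
      have "char (distr unit_lborel borel (X n)) \<theta> = (LINT x|unit_lborel. iexp (\<theta> * X n x))"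
        unfolding char_def by (rule integral_distr) measurable
      also have "\<dots> = integral {0..1} (\<lambda>x. iexp (\<theta> * X n x))"
        by (rule unit_lborel_integral_eq[where B = 1]) auto
      finally show ?thesis by (simp add: X_def)
    qed
    then show "(\<lambda>n. char (distr unit_lborel borel (X n)) \<theta>) \<longlonglongrightarrow> char mix.mixture \<theta>"
      unfolding mix.char_mixture using char_limit[OF lip periodic zero, of \<theta>] by simp
  qed (auto intro: real_distribution_distr mix.real_distribution_mixture)
  \<comment> \<open>Weak convergence gives convergence of distribution functions at the continuity
    points of the limiting one; this equality makes \<open>cont_point\<close> exactly that
    condition.\<close>
  moreover have "cdf mix.mixture = mixed_gaussian_cdf \<phi>"
    unfolding mix.cdf_mixture mixed_gaussian_cdf_def ..
  ultimately have "(\<lambda>n. cdf (distr unit_lborel borel (X n)) t) \<longlonglongrightarrow> mixed_gaussian_cdf \<phi> t"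
    using cont_point unfolding weak_conv_m_def weak_conv_def by simp
  moreover have "cdf (distr unit_lborel borel (X n)) t =
      measure circle_measure {x \<in> space circle_measure. X n x \<le> t}" for n
  proof -
    have "{x. X n x \<le> t} \<in> sets borel" by measurable
    then have "{x \<in> {0..<1}. X n x \<le> t} \<in> sets borel"
      by (simp add: Collect_conj_eq)
    then have "measure circle_measure {x \<in> {0..<1}. X n x \<le> t} = measure unit_lborel {x \<in> {0..<1}. X n x \<le> t}"
      by (intro measure_circle_eq) auto
    moreover have "X n -` {..t} \<inter> space unit_lborel = {x \<in> {0..<1}. X n x \<le> t}"
      by (auto simp: space_restrict_space)
    ultimately show ?thesis
      by (simp add: cdf_def measure_distr space_restrict_space)
  qed
  ultimately show ?thesis unfolding X_def by simp
qed

end
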